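(* Let $d=2$, let $p>q>1$, and let $f_1(r)=r^{-p}$, $f_2(r)=r^{-q}$ for $r>0$. Let $$S_1(p)=4p\sum_{(m,n)\in\mathbb Z^2\setminus\{0\}}\frac{(p+1)(n^2-m^2)^2-2m^4-2m^2n^2}{(m^2+n^2)^{p+2}},$$ $$S_2(q)=4q\sum_{(m,n)\in\mathbb Z^2\setminus\{0\}}\frac{(-1)^{m+n}\left((q+1)(n^2-m^2)^2-2m^4-2m^2n^2\right)}{(m^2+n^2)^{q+2}}.$$ Then there exists a precise value $V_{p,q}>0$, namely $$V_{p,q}=\left(\frac{S_1(p)}{-S_2(q)}\right)^{\frac1{p-q}},$$ such that the following holds: (i) If $0<V<V_{p,q}$, then $V^{1/2}\mathbb Z^2$ is a strict local minimum of $E^\pm_{f_1,f_2}$ in $\mathcal Q(V)$. (ii) If $V>V_{p,q}$, then $V^{1/2}\mathbb Z^2$ is a strict local maximum of $E^\pm_{f_1,f_2}$ in $\mathcal Q(V)$.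
   Context: $\mathcal Q(V)$ is the set of rectangular (orthorhombic) lattices in $\mathbb R^2$ of volume $V$, i.e. lattices $\mathbb Zu_1\oplus\mathbb Zu_2$ with $u_1\perp u_2$ and $|\det(u_1,u_2)|=V$. Up to isometry each such lattice is $V^{1/2}L_y$ with $L_y=\mathbb Z(y,0)\oplus\mathbb Z(0,y^{-1})$ for some $y>0$; the square lattice is $y=1$, and "strict local minimum/maximum in $\mathcal Q(V)$" at $V^{1/2}\mathbb Z^2$ means that $y\mapsto E^\pm_{f_1,f_2}[V^{1/2}L_y]$, $y\in(0,\infty)$, has a strict local minimum/maximum at $y=1$. The alternating-charge energy is $$E^\pm_{f_1,f_2}[L]=\sum_{p\in L\setminus\{0\}}f_1(|p|^2)+\sum_{p\in L\setminus\{0\}}\varphi_\pm(p)f_2(|p|^2),$$ where, for $L=\mathbb Zu_1\oplus\mathbb Zu_2$ with orthogonal basis $u_1,u_2$, $\varphi_\pm(m_1u_1+m_2u_2)=(-1)^{m_1+m_2}$. *)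

theory Defs
  imports "HOL-Analysis.Analysis"
begin

definition lattice_of :: "real^2 \<Rightarrow> real^2 \<Rightarrow> (real^2) set" where
  "lattice_of u1 u2 = {of_int m1 *\<^sub>R u1 + of_int m2 *\<^sub>R u2 | m1 m2. True}"

definition orthogonal_basis :: "(real^2) set \<Rightarrow> real^2 \<Rightarrow> real^2 \<Rightarrow> bool" where
  "orthogonal_basis L u1 u2 \<longleftrightarrow>
     u1 \<noteq> 0 \<and> u2 \<noteq> 0 \<and> orthogonal u1 u2 \<and> L = lattice_of u1 u2"

text \<open>The set \<open>\<Q>(V)\<close> of rectangular lattices of volume \<open>V\<close>, for \<open>V > 0\<close>.\<close>

definition rectangular_lattices :: "real \<Rightarrow> (real^2) set set" where
  "rectangular_lattices V =
     {L. \<exists>u1 u2. orthogonal_basis L u1 u2 \<and> \<bar>det (vector [u1, u2] :: real^2^2)\<bar> = V}"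

text \<open>
  A rectangular lattice determines its orthogonal basis up to order and signs, so the
  alternating charge is a function of the lattice alone; see \<open>charge_eq\<close> below.
\<close>

definition charge :: "(real^2) set \<Rightarrow> real^2 \<Rightarrow> real" where
  "charge L x = (THE s. \<exists>u1 u2 m1 m2. orthogonal_basis L u1 u2 \<and>
     x = of_int m1 *\<^sub>R u1 + of_int m2 *\<^sub>R u2 \<and> s = (-1) powi (m1 + m2))"

definition energy :: "(real \<Rightarrow> real) \<Rightarrow> (real \<Rightarrow> real) \<Rightarrow> (real^2) set \<Rightarrow> real" where
  "energy f1 f2 L =
     (\<Sum>\<^sub>\<infinity>x\<in>L - {0}. f1 ((norm x)\<^sup>2)) + (\<Sum>\<^sub>\<infinity>x\<in>L - {0}. charge L x * f2 ((norm x)\<^sup>2))"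

definition rect_lattice :: "real \<Rightarrow> (real^2) set" where
  "rect_lattice y = lattice_of (vector [y, 0]) (vector [0, inverse y])"

definition scaled_rect_lattice :: "real \<Rightarrow> real \<Rightarrow> (real^2) set" where
  "scaled_rect_lattice V y = (\<lambda>x. sqrt V *\<^sub>R x) ` rect_lattice y"

definition strict_local_min_on :: "('a::topological_space \<Rightarrow> real) \<Rightarrow> 'a set \<Rightarrow> 'a \<Rightarrow> bool" where
  "strict_local_min_on g S x \<longleftrightarrow> x \<in> S \<and> (\<forall>\<^sub>F y in at x within S. g x < g y)"

definition strict_local_max_on :: "('a::topological_space \<Rightarrow> real) \<Rightarrow> 'a set \<Rightarrow> 'a \<Rightarrow> bool" where
  "strict_local_max_on g S x \<longleftrightarrow> x \<in> S \<and> (\<forall>\<^sub>F y in at x within S. g y < g x)"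

text \<open>
  Strict local optimality of the square lattice of volume \<open>V\<close> among the rectangular lattices of
  volume \<open>V\<close>. These are taken up to isometry, that is, along the family
  \<open>scaled_rect_lattice V y\<close>, \<open>y > 0\<close>; the square lattice is \<open>y = 1\<close>. See
  \<open>scaled_rect_lattice_in\<close> and \<open>rectangular_lattice_isometric\<close> below.
\<close>

definition square_strict_local_min :: "((real^2) set \<Rightarrow> real) \<Rightarrow> real \<Rightarrow> bool" where
  "square_strict_local_min E V \<longleftrightarrow>
     strict_local_min_on (\<lambda>y. E (scaled_rect_lattice V y)) {0<..} 1"

definition square_strict_local_max :: "((real^2) set \<Rightarrow> real) \<Rightarrow> real \<Rightarrow> bool" where
  "square_strict_local_max E V \<longleftrightarrow>
     strict_local_max_on (\<lambda>y. E (scaled_rect_lattice V y)) {0<..} 1"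

definition S1 :: "real \<Rightarrow> real" where
  "S1 p = 4 * p * (\<Sum>\<^sub>\<infinity>(m, n)\<in>(UNIV :: (int \<times> int) set) - {(0, 0)}.
     ((p + 1) * (of_int n ^ 2 - of_int m ^ 2) ^ 2 - 2 * of_int m ^ 4
        - 2 * of_int m ^ 2 * of_int n ^ 2)
     / (of_int m ^ 2 + of_int n ^ 2) powr (p + 2))"

definition S2 :: "real \<Rightarrow> real" where
  "S2 q = 4 * q * (\<Sum>\<^sub>\<infinity>(m, n)\<in>(UNIV :: (int \<times> int) set) - {(0, 0)}.
     ((-1) powi (m + n) * ((q + 1) * (of_int n ^ 2 - of_int m ^ 2) ^ 2 - 2 * of_int m ^ 4
        - 2 * of_int m ^ 2 * of_int n ^ 2))
     / (of_int m ^ 2 + of_int n ^ 2) powr (q + 2))"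

definition V_crit :: "real \<Rightarrow> real \<Rightarrow> real" where
  "V_crit p q = (S1 p / - S2 q) powr (1 / (p - q))"


subsection \<open>Consistency of the definitions\<close>

lemma lattice_ofI: "of_int m *\<^sub>R u + of_int n *\<^sub>R v \<in> lattice_of u v"
  unfolding lattice_of_def by blast

lemma basis_in_lattice_of: "u \<in> lattice_of u v" "v \<in> lattice_of u v"
  using lattice_ofI[of 1 u 0 v] lattice_ofI[of 0 u 1 v] by simp_all

lemma orth_coeffs:
  assumes "u \<noteq> 0" "v \<noteq> 0" "orthogonal u v"
    and "a *\<^sub>R u + b *\<^sub>R v = c *\<^sub>R u + d *\<^sub>R (v :: real^2)"
  shows "a = c" "b = d"
proof -
  have uv: "u \<bullet> v = 0" "v \<bullet> u = 0" using assms(3) by (auto simp: orthogonal_def inner_commute)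
  have "(a *\<^sub>R u + b *\<^sub>R v) \<bullet> u = (c *\<^sub>R u + d *\<^sub>R v) \<bullet> u" using assms(4) by simp
  then show "a = c" using assms(1) by (simp add: inner_left_distrib uv)
  have "(a *\<^sub>R u + b *\<^sub>R v) \<bullet> v = (c *\<^sub>R u + d *\<^sub>R v) \<bullet> v" using assms(4) by simp
  then show "b = d" using assms(2) by (simp add: inner_left_distrib uv)
qed

lemma orth_basis_parity:
  assumes B: "orthogonal_basis L u v" "orthogonal_basis L u' v'"
    and x: "of_int m *\<^sub>R u + of_int n *\<^sub>R v = of_int k *\<^sub>R u' + of_int l *\<^sub>R v'"
  shows "even (m + n) \<longleftrightarrow> even (k + l)"
proof -
  have nz: "u \<noteq> 0" "v \<noteq> 0" "u' \<noteq> 0" "v' \<noteq> 0"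
    and o: "orthogonal u v" "orthogonal u' v'"
    and L: "L = lattice_of u v" "L = lattice_of u' v'"
    using B by (auto simp: orthogonal_basis_def)
  have "u' \<in> lattice_of u v" "v' \<in> lattice_of u v" "u \<in> lattice_of u' v'" "v \<in> lattice_of u' v'"
    using basis_in_lattice_of L by metis+
  then obtain a b c d a' b' c' d' :: int where
    e: "u' = of_int a *\<^sub>R u + of_int b *\<^sub>R v" "v' = of_int c *\<^sub>R u + of_int d *\<^sub>R v"
    and e': "u = of_int a' *\<^sub>R u' + of_int b' *\<^sub>R v'" "v = of_int c' *\<^sub>R u' + of_int d' *\<^sub>R v'"
    unfolding lattice_of_def by blast
  have "of_int 1 *\<^sub>R u + of_int 0 *\<^sub>R v
      = of_int (a' * a + b' * c) *\<^sub>R u + of_int (a' * b + b' * d) *\<^sub>R v"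
    using e'(1) unfolding e by (simp add: algebra_simps)
  from orth_coeffs[OF nz(1,2) o(1) this]
  have 1: "a' * a + b' * c = 1" "a' * b + b' * d = 0" by linarith+
  have "of_int 0 *\<^sub>R u + of_int 1 *\<^sub>R v
      = of_int (c' * a + d' * c) *\<^sub>R u + of_int (c' * b + d' * d) *\<^sub>R v"
    using e'(2) unfolding e by (simp add: algebra_simps)
  from orth_coeffs[OF nz(1,2) o(1) this]
  have 2: "c' * a + d' * c = 0" "c' * b + d' * d = 1" by linarith+
  have uv: "u \<bullet> v = 0" "v \<bullet> u = 0" using o(1) by (auto simp: orthogonal_def inner_commute)
  have "u' \<bullet> v' = 0" using o(2) by (simp add: orthogonal_def)
  then have q: "of_int (a * c) * (u \<bullet> u) + of_int (b * d) * (v \<bullet> v) = (0 :: real)"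
    unfolding e by (simp add: inner_left_distrib inner_right_distrib uv algebra_simps)
  have "(a * d - b * c) * (a' * d' - b' * c') = 1"
    using 1 2 by algebra
  then have "\<bar>a * d - b * c\<bar> * \<bar>a' * d' - b' * c'\<bar> = 1"
    by (metis abs_mult abs_one)
  then have D: "\<bar>a * d - b * c\<bar> = 1"
    by (metis abs_ge_zero zmult_eq_1_iff abs_1 abs_zmult_eq_1 abs_abs abs_mult)
  have pos: "u \<bullet> u > 0" "v \<bullet> v > 0" using nz by auto
  have ac: "a * c = 0 \<and> b * d = 0"
  proof (rule ccontr)
    assume "\<not> ?thesis"
    then have *: "a * c \<noteq> 0" "b * d \<noteq> 0" using q pos by auto
    have "a * c * (b * d) < 0"
    proof (rule ccontr)
      assume "\<not> ?thesis"
      then have "a * c * (b * d) > 0" using * by (simp add: order_less_le not_less)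
      then consider "a * c > 0" "b * d > 0" | "a * c < 0" "b * d < 0"
        by (auto simp: zero_less_mult_iff)
      then show False
      proof cases
        case 1
        then have "real_of_int (a * c) * (u \<bullet> u) > 0" "real_of_int (b * d) * (v \<bullet> v) > 0"
          using pos by (metis mult_pos_pos of_int_0_less_iff)+
        then show False using q by linarith
      next
        case 2
        then have "real_of_int (a * c) * (u \<bullet> u) < 0" "real_of_int (b * d) * (v \<bullet> v) < 0"
          using pos by (metis mult_neg_pos of_int_less_0_iff)+
        then show False using q by linarith
      qed
    qed
    then have ads: "(a * d) * (b * c) < 0" by (simp add: algebra_simps)
    then have "a * d \<noteq> 0" "b * c \<noteq> 0" by auto
    moreover have "a * d > 0 \<and> b * c < 0 \<or> a * d < 0 \<and> b * c > 0"
      using ads by (auto simp: mult_less_0_iff)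
    ultimately show False using D by linarith
  qed
  have odd: "odd (a * d - b * c)" using D by (metis dvd_abs_iff odd_one)
  have "odd (a + b)" "odd (c + d)"
    using ac odd by auto
  moreover have "of_int m *\<^sub>R u + of_int n *\<^sub>R v
      = of_int (k * a + l * c) *\<^sub>R u + of_int (k * b + l * d) *\<^sub>R v"
    using x unfolding e by (simp add: algebra_simps)
  from orth_coeffs[OF nz(1,2) o(1) this]
  have "m = k * a + l * c" "n = k * b + l * d" by linarith+
  then have "m + n = k * (a + b) + l * (c + d)" by (simp add: algebra_simps)
  ultimately show ?thesis by simp
qed

lemma charge_eq:
  assumes "orthogonal_basis L u v"
  shows "charge L (of_int m *\<^sub>R u + of_int n *\<^sub>R v) = (-1) powi (m + n)"
  unfolding charge_def
proof (rule the_equality)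
  show "\<exists>u1 u2 m1 m2. orthogonal_basis L u1 u2 \<and>
     of_int m *\<^sub>R u + of_int n *\<^sub>R v = of_int m1 *\<^sub>R u1 + of_int m2 *\<^sub>R u2 \<and>
     (-1) powi (m + n) = ((-1) powi (m1 + m2) :: real)"
    using assms by blast
next
  fix s :: real
  assume "\<exists>u1 u2 m1 m2. orthogonal_basis L u1 u2 \<and>
     of_int m *\<^sub>R u + of_int n *\<^sub>R v = of_int m1 *\<^sub>R u1 + of_int m2 *\<^sub>R u2 \<and>
     s = (-1) powi (m1 + m2)"
  then obtain u1 u2 k l where *: "orthogonal_basis L u1 u2"
    "of_int m *\<^sub>R u + of_int n *\<^sub>R v = of_int k *\<^sub>R u1 + of_int l *\<^sub>R u2" "s = (-1) powi (k + l)"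
    by blast
  show "s = (-1) powi (m + n)"
    using orth_basis_parity[OF assms *(1,2)] *(3) by (simp add: power_int_minus_left)
qed

lemma scaled_rect_lattice_eq:
  "scaled_rect_lattice V y = lattice_of (vector [sqrt V * y, 0]) (vector [0, sqrt V * inverse y])"
proof -
  have s: "sqrt V *\<^sub>R (of_int m *\<^sub>R vector [y, 0] + of_int n *\<^sub>R vector [0, inverse y])
     = of_int m *\<^sub>R (vector [sqrt V * y, 0] :: real^2)
       + of_int n *\<^sub>R vector [0, sqrt V * inverse y]" for m n
    by (simp add: vec_eq_iff forall_2 algebra_simps)
  show ?thesis
    unfolding scaled_rect_lattice_def rect_lattice_def lattice_of_def
  proof (intro equalityI subsetI; elim imageE CollectE exE conjE)
    fix x m n
    assume "x = of_int m *\<^sub>R (vector [sqrt V * y, 0] :: real^2)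
       + of_int n *\<^sub>R vector [0, sqrt V * inverse y]"
    then show "x \<in> (\<lambda>x. sqrt V *\<^sub>R x) `
        {of_int m1 *\<^sub>R vector [y, 0] + of_int m2 *\<^sub>R vector [0, inverse y] | m1 m2. True}"
      by (intro image_eqI[where x = "of_int m *\<^sub>R vector [y, 0] + of_int n *\<^sub>R vector [0, inverse y]"])
        (use s in auto)
  qed (use s in auto)
qed

lemma scaled_rect_lattice_in:
  assumes "V > 0" "y > 0"
  shows "scaled_rect_lattice V y \<in> rectangular_lattices V"
proof -
  have "orthogonal_basis (scaled_rect_lattice V y)
      (vector [sqrt V * y, 0]) (vector [0, sqrt V * inverse y])"
    using assms by (auto simp: orthogonal_basis_def scaled_rect_lattice_eq orthogonal_def
        inner_vec_def sum_2 vec_eq_iff forall_2)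
  moreover have "\<bar>det (vector [vector [sqrt V * y, 0], vector [0, sqrt V * inverse y]]
      :: real^2^2)\<bar> = V"
    using assms by (simp add: det_2 field_simps)
  ultimately show ?thesis unfolding rectangular_lattices_def by blast
qed

lemma rectangular_lattice_isometric:
  assumes "V > 0" "L \<in> rectangular_lattices V"
  shows "\<exists>T y. orthogonal_transformation T \<and> y > 0 \<and> L = T ` scaled_rect_lattice V y"
proof -
  from assms(2) obtain u v where B: "orthogonal_basis L u v"
    and V: "\<bar>det (vector [u, v] :: real^2^2)\<bar> = V"
    unfolding rectangular_lattices_def by blast
  have nz: "u \<noteq> 0" "v \<noteq> 0" and o: "u \<bullet> v = 0" and L: "L = lattice_of u v"
    using B by (auto simp: orthogonal_basis_def orthogonal_def)
  have "(norm u)\<^sup>2 * (norm v)\<^sup>2 = V\<^sup>2"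
  proof -
    have "V\<^sup>2 = (u$1 * v$2 - u$2 * v$1)\<^sup>2"
      using V by (metis det_2 power2_abs vector_2)
    moreover have "u$1 * v$1 + u$2 * v$2 = 0"
      using o by (simp add: inner_vec_def sum_2)
    moreover have "(norm u)\<^sup>2 = (u$1)\<^sup>2 + (u$2)\<^sup>2" "(norm v)\<^sup>2 = (v$1)\<^sup>2 + (v$2)\<^sup>2"
      unfolding power2_norm_eq_inner by (simp_all add: inner_vec_def sum_2 power2_eq_square)
    ultimately show ?thesis by algebra
  qed
  then have n: "norm u * norm v = V"
    using assms(1) by (metis power_mult_distrib power2_eq_iff_nonneg mult_nonneg_nonneg norm_ge_zero less_imp_le)
  define y where "y = norm u / sqrt V"
  have y: "y > 0" using nz assms by (simp add: y_def)
  have yu: "sqrt V * y = norm u" using assms(1) by (simp add: y_def)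
  have yv: "sqrt V * inverse y = norm v"
    using assms(1) nz n by (simp add: y_def field_simps)
  define a b where "a = u /\<^sub>R norm u" and "b = v /\<^sub>R norm v"
  have ab: "a \<bullet> a = 1" "b \<bullet> b = 1" "a \<bullet> b = 0"
    using nz o by (simp_all add: a_def b_def dot_square_norm power2_eq_square)
  define T :: "real^2 \<Rightarrow> real^2" where "T = (\<lambda>x. (x$1) *\<^sub>R a + (x$2) *\<^sub>R b)"
  have "linear T"
    by (rule linearI) (simp_all add: T_def algebra_simps)
  moreover have "T x \<bullet> T z = x \<bullet> z" for x z
  proof -
    have "b \<bullet> a = 0" using ab by (simp add: inner_commute)
    then show ?thesis
      by (simp add: T_def inner_left_distrib inner_right_distrib ab inner_vec_def[of x z] sum_2)
  qed
  ultimately have T: "orthogonal_transformation T"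
    by (simp add: orthogonal_transformation_def)
  have "T (of_int m *\<^sub>R vector [norm u, 0] + of_int n *\<^sub>R vector [0, norm v])
      = of_int m *\<^sub>R u + of_int n *\<^sub>R v" for m n
    using nz by (simp add: T_def a_def b_def field_simps)
  then have "T ` scaled_rect_lattice V y = L"
    unfolding scaled_rect_lattice_eq yu yv L lattice_of_def
    by (auto simp: image_iff) metis
  then show ?thesis using T y by blast
qed

end

theory Submission
  imports Defs
begin

text \<open>
  For \<open>z = m + i n\<close> at angle \<open>\<theta>\<close>, the second derivative at \<open>y = 1\<close> of the energy with kernel
  \<open>r powr (-s)\<close> is \<open>2 s ((s - 1) Z + (s + 1) H)\<close>, where \<open>Z\<close> and \<open>H\<close> are the sums of
  \<open>|z| powr (-2 s)\<close> and of \<open>cos (4 \<theta>) |z| powr (-2 s)\<close>. Multiplication by \<open>1 + i\<close> maps the lattice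
  onto its points of even coordinate sum, doubles \<open>|z|\<^sup>2\<close> and changes the sign of \<open>cos (4 \<theta>)\<close>. Hence with
  alternating charges the derivative is \<open>-2 s ((s - 1) (1 - a) Z + (s + 1) (1 + a) H)\<close>,
  \<open>a = 2 powr (1 - s) < 1\<close>. Everything therefore rests on \<open>H > 0\<close>. Now \<open>H\<close> is the sum of the
  completely multiplicative function \<open>(z / |z|)^4 |z| powr (-2 s)\<close> over the Gaussian integers. It
  cannot vanish for \<open>s > 1\<close>: if it did, sieving out finitely many Gaussian primes would still leave
  a zero sum, although the four units alone contribute \<open>4\<close>. As \<open>H\<close> is continuous in \<open>s\<close> and
  positive for large \<open>s\<close>, it is positive throughout.
\<close>


subsection \<open>Sieving sums over the Gaussian integers\<close>

text \<open>A subset of the complex numbers rather than a type of its own, so that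
  \<open>cmod\<close>, \<open>cnj\<close> and complex division apply directly.\<close>

definition gauss_ints :: "complex set" where
  "gauss_ints = {z. Re z \<in> \<int> \<and> Im z \<in> \<int>}"

definition gauss_dvd :: "complex \<Rightarrow> complex \<Rightarrow> bool" where
  "gauss_dvd w z \<longleftrightarrow> (\<exists>k\<in>gauss_ints. z = w * k)"

text \<open>The bound on \<open>cmod w\<close> excludes zero and the units. The divisibility
  property, rather than irreducibility, is what the sieve uses.\<close>

definition gauss_prime :: "complex \<Rightarrow> bool" where
  "gauss_prime w \<longleftrightarrow> w \<in> gauss_ints \<and> cmod w > 1 \<and>
     (\<forall>a\<in>gauss_ints. \<forall>b\<in>gauss_ints. gauss_dvd w (a * b) \<longrightarrow> gauss_dvd w a \<or> gauss_dvd w b)"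

lemma gauss_ints_0 [simp]: "0 \<in> gauss_ints"
  and gauss_ints_1 [simp]: "1 \<in> gauss_ints"
  by (simp_all add: gauss_ints_def)

lemma gauss_ints_add [intro]: "a \<in> gauss_ints \<Longrightarrow> b \<in> gauss_ints \<Longrightarrow> a + b \<in> gauss_ints"
  and gauss_ints_diff [intro]: "a \<in> gauss_ints \<Longrightarrow> b \<in> gauss_ints \<Longrightarrow> a - b \<in> gauss_ints"
  and gauss_ints_mult [intro]: "a \<in> gauss_ints \<Longrightarrow> b \<in> gauss_ints \<Longrightarrow> a * b \<in> gauss_ints"
  and gauss_ints_cnj [intro]: "a \<in> gauss_ints \<Longrightarrow> cnj a \<in> gauss_ints"
  by (simp_all add: gauss_ints_def)

lemma gauss_norm_sq_Ints:
  assumes "z \<in> gauss_ints" shows "(cmod z)\<^sup>2 \<in> \<int>"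
  using assms by (auto simp: gauss_ints_def cmod_power2)

lemma gauss_norm_ge_1:
  assumes "z \<in> gauss_ints" "z \<noteq> 0" shows "cmod z \<ge> 1"
proof -
  have "(cmod z)\<^sup>2 \<in> \<int>" "(cmod z)\<^sup>2 > 0" using assms gauss_norm_sq_Ints by auto
  then obtain k where k: "(cmod z)\<^sup>2 = of_int k" by (auto elim!: Ints_cases)
  with \<open>(cmod z)\<^sup>2 > 0\<close> have "k > 0" by simp
  then have "1\<^sup>2 \<le> (cmod z)\<^sup>2" unfolding k by simp
  then show ?thesis by (rule power2_le_imp_le) simp
qed

section \<open>Units, divisibility and Euclidean division\<close>

lemma gauss_unit_inverse:
  assumes "z \<in> gauss_ints" "cmod z = 1" shows "gauss_dvd z 1"
proof -
  have "z * cnj z = 1" using assms(2) by (simp add: complex_norm_square[symmetric])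
  then show ?thesis using assms(1) unfolding gauss_dvd_def by (metis gauss_ints_cnj)
qed

lemma gauss_dvd_trans: "gauss_dvd a b \<Longrightarrow> gauss_dvd b c \<Longrightarrow> gauss_dvd a c"
  unfolding gauss_dvd_def by (metis gauss_ints_mult mult.assoc)

lemma gauss_dvd_mult: "gauss_dvd a b \<Longrightarrow> c \<in> gauss_ints \<Longrightarrow> gauss_dvd a (b * c)"
  unfolding gauss_dvd_def by (metis gauss_ints_mult mult.assoc)

lemma gauss_dvd_add: "gauss_dvd a b \<Longrightarrow> gauss_dvd a c \<Longrightarrow> gauss_dvd a (b + c)"
  unfolding gauss_dvd_def by (metis gauss_ints_add distrib_left)

text \<open>Rounding both coordinates of \<open>a / b\<close> leaves an error of at most 1/2 in
  each, hence of squared norm at most 1/2.\<close>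

lemma gauss_division:
  assumes "a \<in> gauss_ints" "b \<in> gauss_ints" "b \<noteq> 0"
  obtains k where "k \<in> gauss_ints" "cmod (a - b * k) < cmod b"
proof
  define w where "w = a / b"
  define k where "k = Complex (of_int (round (Re w))) (of_int (round (Im w)))"
  show "k \<in> gauss_ints" by (simp add: k_def gauss_ints_def)
  have "(Re (w - k))\<^sup>2 \<le> (1/2)\<^sup>2" "(Im (w - k))\<^sup>2 \<le> (1/2)\<^sup>2"
    using of_int_round_abs_le[of "Re w"] of_int_round_abs_le[of "Im w"]
    by (auto simp: k_def abs_le_square_iff[symmetric] abs_minus_commute)
  then have "(cmod (w - k))\<^sup>2 < 1\<^sup>2"
    unfolding cmod_power2 by (simp add: power2_eq_square)
  then have "cmod (w - k) < 1"
    by (rule power2_less_imp_less) simp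
  then have "cmod b * cmod (w - k) < cmod b" using assms(3) by simp
  moreover have "a - b * k = b * (w - k)" using assms(3) by (simp add: w_def algebra_simps)
  ultimately show "cmod (a - b * k) < cmod b" by (simp add: norm_mult)
qed

text \<open>Squared norms of Gaussian integers are natural numbers, so a minimum is attained. This
  serves twice: for a shortest non-unit divisor and for a shortest nonzero element of an
  ideal.\<close>

lemma gauss_least_norm:
  assumes "z \<in> gauss_ints" "P z"
  obtains w where "w \<in> gauss_ints" "P w" "\<And>x. x \<in> gauss_ints \<Longrightarrow> P x \<Longrightarrow> cmod w \<le> cmod x"
proof -
  define N where "N x = nat \<lfloor>(cmod x)\<^sup>2\<rfloor>" for x
  have N: "real (N x) = (cmod x)\<^sup>2" if "x \<in> gauss_ints" for x
    using gauss_norm_sq_Ints[OF that] by (auto simp: N_def elim!: Ints_cases)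
  obtain w where w: "w \<in> gauss_ints \<and> P w" "\<And>x. x \<in> gauss_ints \<and> P x \<Longrightarrow> N w \<le> N x"
    using ex_has_least_nat[of "\<lambda>x. x \<in> gauss_ints \<and> P x" z N] assms by blast
  show ?thesis
  proof
    fix x assume "x \<in> gauss_ints" "P x"
    then have "(cmod w)\<^sup>2 \<le> (cmod x)\<^sup>2" using w N by (metis of_nat_le_iff)
    then show "cmod w \<le> cmod x" by (rule power2_le_imp_le) simp
  qed (use w in auto)
qed

text \<open>A divisor of least norm among the non-units is prime, by Bezout's identity.\<close>

lemma gauss_prime_divisor:
  assumes "z \<in> gauss_ints" "cmod z > 1"
  obtains w where "gauss_prime w" "gauss_dvd w z"
proof -
  obtain w where w: "w \<in> gauss_ints" "cmod w > 1 \<and> gauss_dvd w z"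
    "\<And>x. x \<in> gauss_ints \<Longrightarrow> cmod x > 1 \<and> gauss_dvd x z \<Longrightarrow> cmod w \<le> cmod x"
    using gauss_least_norm[of z "\<lambda>x. cmod x > 1 \<and> gauss_dvd x z"] assms
    unfolding gauss_dvd_def by (metis gauss_ints_1 mult.right_neutral)
  have "gauss_dvd w a \<or> gauss_dvd w b"
    if ab: "a \<in> gauss_ints" "b \<in> gauss_ints" "gauss_dvd w (a * b)" for a b
  proof -
    \<comment> \<open>\<open>I\<close> singles out the nonzero elements of the ideal generated by
      \<open>w\<close> and \<open>a\<close>; a shortest one will generate that ideal.\<close>
    define I where "I d \<longleftrightarrow> d \<noteq> 0 \<and> (\<exists>x\<in>gauss_ints. \<exists>y\<in>gauss_ints. d = w * x + a * y)" for d
    have "I w" unfolding I_def using w(2) by (force intro: bexI[of _ 1] bexI[of _ 0])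
    then obtain d where d: "d \<in> gauss_ints" "I d"
      "\<And>x. x \<in> gauss_ints \<Longrightarrow> I x \<Longrightarrow> cmod d \<le> cmod x"
      using gauss_least_norm[of w I] w(1) by blast
    then obtain x y where xy: "x \<in> gauss_ints" "y \<in> gauss_ints" "d = w * x + a * y" and d0: "d \<noteq> 0"
      unfolding I_def by blast
    have dv: "gauss_dvd d c"
      if c: "x' \<in> gauss_ints" "y' \<in> gauss_ints" "c = w * x' + a * y'" for c x' y'
    proof -
      have cG: "c \<in> gauss_ints" using c w(1) ab(1) by auto
      obtain k where k: "k \<in> gauss_ints" "cmod (c - d * k) < cmod d"
        using gauss_division[OF cG d(1) d0] .
      have "c - d * k = w * (x' - x * k) + a * (y' - y * k)"
        by (simp add: c xy(3) algebra_simps)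
      moreover have "x' - x * k \<in> gauss_ints" "y' - y * k \<in> gauss_ints" "c - d * k \<in> gauss_ints"
        using c xy k d cG by auto
      \<comment> \<open>The remainder lies in the ideal and is shorter than \<open>d\<close>, so it
        vanishes.\<close>
      ultimately have "c - d * k = 0" using d(3)[of "c - d * k"] k(2) unfolding I_def by fastforce
      then show ?thesis using k(1) unfolding gauss_dvd_def by auto
    qed
    have dw: "gauss_dvd d w" using dv[of 1 0] by simp
    have da: "gauss_dvd d a" using dv[of 0 1] by simp
    show ?thesis
    proof (cases "cmod d > 1")
      case True
      \<comment> \<open>\<open>d\<close> divides \<open>w\<close> and hence \<open>z\<close>, so
        minimality of \<open>w\<close> forces the cofactor \<open>k\<close> to be a unit:
        \<open>w\<close> and \<open>d\<close> are associates.\<close>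
      then have le: "cmod w \<le> cmod d" using w(2,3) d(1) dw gauss_dvd_trans by blast
      obtain k where k: "k \<in> gauss_ints" "w = d * k" using dw unfolding gauss_dvd_def by blast
      have "cmod d * cmod k \<le> cmod d * 1" using le k(2) by (simp add: norm_mult)
      then have "cmod k \<le> 1" using d0 by (simp add: mult_le_cancel_left)
      moreover have "k \<noteq> 0" using k(2) w(2) by auto
      ultimately have "cmod k = 1" using gauss_norm_ge_1[OF k(1)] by simp
      then obtain k' where "k' \<in> gauss_ints" "1 = k * k'"
        using gauss_unit_inverse[OF k(1)] unfolding gauss_dvd_def by blast
      then have "gauss_dvd w d" unfolding gauss_dvd_def k(2) by (metis mult.assoc mult.right_neutral)
      then show ?thesis using da gauss_dvd_trans by blast
    next
      case False
      then have "cmod d = 1" using gauss_norm_ge_1[OF d(1) d0] by simp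
      then obtain d' where d': "d' \<in> gauss_ints" "1 = d * d'"
        using gauss_unit_inverse[OF d(1)] unfolding gauss_dvd_def by blast
      \<comment> \<open>Bezout's identity times \<open>b\<close> writes \<open>b * d\<close> as a
        sum of two multiples of \<open>w\<close>; the inverse \<open>d'\<close> of the unit
        \<open>d\<close> then removes \<open>d\<close>.\<close>
      have "gauss_dvd w (w * (x * b))"
        using xy ab unfolding gauss_dvd_def by blast
      then have "gauss_dvd w (w * (x * b) + a * b * y)"
        using gauss_dvd_mult[OF ab(3) xy(2)] by (rule gauss_dvd_add)
      then have "gauss_dvd w ((w * (x * b) + a * b * y) * d')" using d'(1) by (rule gauss_dvd_mult)
      also have "(w * (x * b) + a * b * y) * d' = b * (d * d')" by (simp add: xy(3) algebra_simps)
      finally show ?thesis using d'(2) by simp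
    qed
  qed
  then have "gauss_prime w" using w unfolding gauss_prime_def by blast
  then show ?thesis using w(2) that by blast
qed

text \<open>The multiples of a new prime \<open>w\<close> among the surviving points are exactly
  \<open>w\<close> times the surviving points. By multiplicativity their sum is \<open>g w\<close>
  times the old sum, hence zero, and removing them changes nothing.\<close>

lemma sieved_sum_eq_0:
  fixes g :: "complex \<Rightarrow> complex"
  assumes mult: "\<And>a b. a \<in> gauss_ints - {0} \<Longrightarrow> b \<in> gauss_ints - {0} \<Longrightarrow> g (a * b) = g a * g b"
    and sum: "g summable_on (gauss_ints - {0})" and zero: "infsum g (gauss_ints - {0}) = 0"
    and "finite P" "\<forall>w\<in>P. gauss_prime w"
  shows "infsum g {z \<in> gauss_ints - {0}. \<forall>w\<in>P. \<not> gauss_dvd w z} = 0"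
  using assms(4,5)
proof (induction rule: finite_induct)
  case empty
  have "{z \<in> gauss_ints - {0}. \<forall>w\<in>{}. \<not> gauss_dvd w z} = gauss_ints - {0}" by blast
  then show ?case using zero by simp
next
  case (insert w P)
  define A where "A = {z \<in> gauss_ints - {0}. \<forall>w\<in>P. \<not> gauss_dvd w z}"
  define B where "B = {z \<in> gauss_ints - {0}. \<forall>w\<in>insert w P. \<not> gauss_dvd w z}"
  have IH: "infsum g A = 0" using insert unfolding A_def by blast
  have w: "w \<in> gauss_ints - {0}" using insert.prems by (auto simp: gauss_prime_def)
  have "infsum g B = 0"
  proof (cases "\<exists>v\<in>P. gauss_dvd v w")
    case True
    \<comment> \<open>All multiples of \<open>w\<close> were already removed together with those of
      \<open>v\<close>.\<close>
    then have "B = A" unfolding A_def B_def using gauss_dvd_trans by blast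
    then show ?thesis using IH by simp
  next
    case False
    have AB: "A - B = (*) w ` A"
    proof (intro equalityI subsetI)
      fix z assume z: "z \<in> A - B"
      then obtain k where k: "k \<in> gauss_ints" "z = w * k"
        unfolding A_def B_def gauss_dvd_def by blast
      have "\<not> gauss_dvd v k" if "v \<in> P" for v
        using that z w gauss_dvd_mult[of v k w] unfolding A_def k(2) by (auto simp: mult.commute)
      then have "k \<in> A" using k z unfolding A_def by auto
      then show "z \<in> (*) w ` A" using k by blast
    next
      fix z assume "z \<in> (*) w ` A"
      then obtain k where k: "k \<in> A" "z = w * k" by blast
      \<comment> \<open>Primality of \<open>v\<close> enters here: if \<open>v\<close> divided
        \<open>w * k\<close>, it would divide \<open>w\<close> or \<open>k\<close>.\<close>
      have "\<not> gauss_dvd v z" if "v \<in> P" for v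
        using that insert.prems False k w unfolding gauss_prime_def A_def by blast
      moreover have "gauss_dvd w z" using k unfolding A_def gauss_dvd_def by blast
      ultimately show "z \<in> A - B" using k w unfolding A_def B_def by auto
    qed
    have sA: "g summable_on A" "g summable_on B"
      unfolding A_def B_def by (rule summable_on_subset_banach[OF sum], blast)+
    have "infsum g (A - B) = infsum (\<lambda>z. g (w * z)) A"
      unfolding AB using w by (subst infsum_reindex) (auto simp: inj_on_def o_def)
    also have "\<dots> = infsum (\<lambda>z. g w * g z) A"
      using mult w by (intro infsum_cong) (auto simp: A_def)
    also have "\<dots> = 0" using IH by (simp add: infsum_cmult_right')
    finally have "infsum g A - infsum g B = 0"
      using infsum_Diff[OF sA(1,2)] unfolding A_def B_def by auto
    then show ?thesis using IH by simp
  qed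
  then show ?case unfolding B_def .
qed

text \<open>
  The primes dividing the finitely many dominant non-units sieve them out, and what is left
  is the sum over the units up to a small error.
\<close>

lemma multiplicative_gauss_sum_nonzero:
  fixes g :: "complex \<Rightarrow> complex"
  assumes mult: "\<And>a b. a \<in> gauss_ints - {0} \<Longrightarrow> b \<in> gauss_ints - {0} \<Longrightarrow> g (a * b) = g a * g b"
    and sum: "(\<lambda>z. norm (g z)) summable_on (gauss_ints - {0})"
    and units: "\<And>z. z \<in> gauss_ints \<Longrightarrow> cmod z = 1 \<Longrightarrow> g z = 1"
  shows "infsum g (gauss_ints - {0}) \<noteq> 0"
proof
  assume zero: "infsum g (gauss_ints - {0}) = 0"
  define G where "G = gauss_ints - {0}"
  define N where "N z = norm (g z)" for z
  have sumN: "N summable_on G" using sum unfolding N_def G_def .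
  obtain F where F: "finite F" "F \<subseteq> G" "dist (sum N F) (infsum N G) \<le> 1/2"
    using infsum_finite_approximation[OF sumN, of "1/2"] by (metis half_gt_zero_iff zero_less_one)
  \<comment> \<open>Adjoining 1 guarantees at least one surviving unit in the finite part.\<close>
  define F' where "F' = insert 1 F"
  have F': "finite F'" "F' \<subseteq> G" using F by (auto simp: F'_def G_def)
  \<comment> \<open>One prime divisor for each non-unit of \<open>F\<close>; sieving by these leaves
    only units in \<open>F\<close>.\<close>
  define pd where "pd z = (SOME w. gauss_prime w \<and> gauss_dvd w z)" for z
  define P where "P = pd ` (F - {z. cmod z = 1})"
  have pd: "gauss_prime (pd z) \<and> gauss_dvd (pd z) z" if "z \<in> F" "cmod z \<noteq> 1" for z
    unfolding pd_def
  proof (rule someI_ex)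
    have "z \<in> gauss_ints" "cmod z > 1"
      using that F gauss_norm_ge_1[of z] by (force simp: G_def)+
    then show "\<exists>w. gauss_prime w \<and> gauss_dvd w z" using gauss_prime_divisor by metis
  qed
  define A where "A = {z \<in> G. \<forall>w\<in>P. \<not> gauss_dvd w z}"
  have gG: "g summable_on G" using sum unfolding G_def by (rule abs_summable_summable)
  have A0: "infsum g A = 0" unfolding A_def G_def
    by (rule sieved_sum_eq_0[OF mult gG[unfolded G_def] zero]) (use F pd in \<open>auto simp: P_def\<close>)
  have "\<not> gauss_dvd w 1" if "w \<in> P" for w
  proof
    assume "gauss_dvd w 1"
    then obtain k where k: "k \<in> gauss_ints" "1 = w * k" unfolding gauss_dvd_def by blast
    have "cmod w > 1" using that pd unfolding P_def gauss_prime_def by blast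
    moreover have "cmod k \<ge> 1" using k gauss_norm_ge_1[of k] by (cases "k = 0") auto
    moreover have "cmod w * cmod k = 1" using k(2) by (metis norm_mult norm_one)
    ultimately show False by (smt (verit) mult_le_cancel_left1)
  qed
  then have 1: "1 \<in> A \<inter> F'" by (auto simp: A_def G_def F'_def)
  have u: "g z = 1" if "z \<in> A \<inter> F'" for z
  proof -
    have "cmod z = 1"
      using that pd[of z] unfolding A_def F'_def P_def by auto
    then show ?thesis using that units unfolding A_def G_def by blast
  qed
  have AG: "A \<subseteq> G" unfolding A_def by blast
  have sub: "N summable_on X" "g summable_on X" if "X \<subseteq> G" for X
    using summable_on_subset_banach[OF sumN that] summable_on_subset_banach[OF gG that] by auto
  \<comment> \<open>Surviving points outside \<open>F'\<close> lie outside \<open>F\<close>, where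
    the absolute sum is at most 1/2.\<close>
  have "infsum N (A - F') \<le> infsum N (G - F)"
    by (rule infsum_mono2) (use AG in \<open>auto intro!: sub simp: F'_def N_def\<close>)
  also have "\<dots> = infsum N G - sum N F"
    using infsum_Diff[OF sumN sub(1)[OF F(2)] F(2)] F(1) by simp
  also have "\<dots> < 1" using F(3) unfolding dist_real_def by linarith
  finally have tail: "infsum N (A - F') < 1" .
  have "infsum g (A \<inter> F') = of_nat (card (A \<inter> F'))"
    using F' u by simp
  moreover have "infsum g A = infsum g (A \<inter> F') + infsum g (A - F')"
    using AG by (subst infsum_Un_disjoint[symmetric]) (auto intro!: sub arg_cong[of _ _ "infsum g"])
  \<comment> \<open>The surviving units add up to a positive integer, which a tail of norm below 1
    would have to cancel.\<close>
  ultimately have "norm (infsum g (A - F')) = card (A \<inter> F')"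
    using A0 by (metis add_eq_0_iff norm_minus_cancel norm_of_nat)
  moreover have "card (A \<inter> F') \<ge> 1" using 1 F' by (metis card_0_eq empty_iff finite_Int less_one linorder_not_le)
  moreover have "norm (infsum g (A - F')) \<le> infsum N (A - F')"
    unfolding N_def using sub(1)[of "A - F'", unfolded N_def] AG by (intro norm_infsum_bound) auto
  ultimately show False using tail by linarith
qed


subsection \<open>The angular lattice sum\<close>

definition punctured_lattice :: "(int \<times> int) set" where
  "punctured_lattice = UNIV - {(0, 0)}"

definition nsq :: "int \<times> int \<Rightarrow> real" where
  "nsq z = of_int (fst z) ^ 2 + of_int (snd z) ^ 2"

text \<open>In polar coordinates, \<open>cos2\<close> is \<open>cos (2 \<theta>)\<close> and \<open>2 (cos2)\<^sup>2 - 1\<close> is \<open>cos (4 \<theta>)\<close>.\<close>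

definition cos2 :: "int \<times> int \<Rightarrow> real" where
  "cos2 z = (of_int (fst z) ^ 2 - of_int (snd z) ^ 2) / nsq z"

section \<open>Elementary bounds and absolute convergence\<close>

lemma nsq_nonneg [simp]: "nsq z \<ge> 0"
  by (simp add: nsq_def)

lemma nsq_ge_1: 
  assumes "z \<in> punctured_lattice" shows "nsq z \<ge> 1"
proof -
  obtain m n where z: "z = (m, n)" by fastforce
  have "m\<^sup>2 + n\<^sup>2 \<noteq> 0" "m\<^sup>2 + n\<^sup>2 \<ge> 0"
    using assms z by (auto simp: punctured_lattice_def sum_power2_eq_zero_iff)
  then have "m\<^sup>2 + n\<^sup>2 \<ge> 1" by linarith
  then have "real_of_int (m\<^sup>2 + n\<^sup>2) \<ge> 1" by linarith
  then show ?thesis by (simp add: z nsq_def)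
qed

lemma nsq_pos: "z \<in> punctured_lattice \<Longrightarrow> nsq z > 0"
  using nsq_ge_1 by fastforce

lemma abs_cos2_le_1: "\<bar>cos2 z\<bar> \<le> 1"
proof -
  have "\<bar>of_int (fst z) ^ 2 - of_int (snd z) ^ 2\<bar> \<le> nsq z"
    by (simp add: nsq_def abs_le_iff)
  then show ?thesis unfolding cos2_def abs_divide using nsq_nonneg[of z] by (auto simp: divide_le_eq)
qed

lemma cos2_square_le_1: "(cos2 z)\<^sup>2 \<le> 1"
  using abs_cos2_le_1 by (simp add: abs_square_le_1)

text \<open>The truncation by 1 gives the index 0 the value 1, so that products over two coordinates
  also dominate the terms on the axes.\<close>

lemma summable_max_powr_int:
  assumes "s > 1"
  shows "(\<lambda>k::int. max 1 \<bar>real_of_int k\<bar> powr (-s)) summable_on UNIV"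
proof -
  define f where "f = (\<lambda>k::int. max 1 \<bar>real_of_int k\<bar> powr (-s))"
  have "summable (\<lambda>n. real n powr (-s))" using assms by (subst summable_real_powr_iff) auto
  then have "summable (\<lambda>n. real (Suc n) powr (-s))" by (subst summable_Suc_iff)
  then have "summable (\<lambda>n. f (int (Suc n)))" by (simp add: f_def)
  then have "summable (\<lambda>n. f (int n))" by (subst (asm) summable_Suc_iff)
  then have *: "(\<lambda>n. f (int n)) summable_on UNIV"
    by (intro norm_summable_imp_summable_on) (simp add: f_def)
  have "f summable_on range int" using * by (subst summable_on_reindex) (auto simp: o_def)
  moreover have "f summable_on range (\<lambda>n. - int n)"
    using * by (subst summable_on_reindex) (auto simp: o_def f_def inj_on_def)
  ultimately have "f summable_on (range int \<union> range (\<lambda>n. - int n))" by (rule summable_on_union)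
  moreover have "range int \<union> range (\<lambda>n. - int n) = UNIV"
    by (metis (mono_tags) UNIV_eq_I UnCI int_cases2 rangeI)
  ultimately show ?thesis unfolding f_def by simp
qed

text \<open>With \<open>a k = max 1 |k|\<close>, the product \<open>a m * a n\<close> is at most
  \<open>nsq (m, n)\<close>, because 2|mn| <= m^2 + n^2 and |k| <= k^2 for integers. The double sum
  is thus dominated by a product of two convergent single sums.\<close>

lemma summable_nsq_powr:
  assumes "s > 1"
  shows "(\<lambda>z. nsq z powr (-s)) summable_on punctured_lattice"
proof -
  define a where "a = (\<lambda>k::int. max 1 \<bar>real_of_int k\<bar>)"
  define b where "b = (\<lambda>z. a (fst z) powr (-s) * a (snd z) powr (-s))"
  have a: "(\<lambda>k. a k powr (-s)) summable_on UNIV"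
    unfolding a_def by (rule summable_max_powr_int[OF assms])
  have "b summable_on UNIV \<times> UNIV"
  proof (rule summable_on_SigmaI[where g = "\<lambda>k. a k powr (-s) * infsum (\<lambda>k. a k powr (-s)) UNIV"])
    show "((\<lambda>y. b (x, y)) has_sum a x powr - s * (\<Sum>\<^sub>\<infinity>k. a k powr - s)) UNIV" for x
      unfolding b_def fst_conv snd_conv using a by (intro has_sum_cmult_right has_sum_infsum)
    show "(\<lambda>k. a k powr (-s) * infsum (\<lambda>k. a k powr (-s)) UNIV) summable_on UNIV"
      using a by (rule summable_on_cmult_left)
  qed (simp add: b_def)
  then have "b summable_on punctured_lattice"
    by (rule summable_on_subset_banach) auto
  then show ?thesis
  proof (rule summable_on_comparison_test)
    fix z assume z: "z \<in> punctured_lattice"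
    obtain m n where mn: "z = (m, n)" by fastforce
    have "a m * a n \<le> nsq z"
    proof -
      have ab: "\<bar>real_of_int k\<bar> \<le> of_int k ^ 2" for k
      proof (cases "k = 0")
        case False
        then have "1 \<le> \<bar>real_of_int k\<bar>" by linarith
        then show ?thesis using self_le_power[of "\<bar>real_of_int k\<bar>" 2] by simp
      qed simp
      have "2 * (\<bar>real_of_int m\<bar> * \<bar>real_of_int n\<bar>) \<le> of_int m ^ 2 + of_int n ^ 2"
        using sum_squares_bound[of "\<bar>real_of_int m\<bar>" "\<bar>real_of_int n\<bar>"] by simp
      then have "\<bar>real_of_int m\<bar> * \<bar>real_of_int n\<bar> \<le> nsq z"
        using mult_nonneg_nonneg[of "\<bar>real_of_int m\<bar>" "\<bar>real_of_int n\<bar>"]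
        unfolding nsq_def mn fst_conv snd_conv by linarith
      moreover have "\<bar>real_of_int m\<bar> \<le> nsq z" "\<bar>real_of_int n\<bar> \<le> nsq z"
        using ab[of m] ab[of n] by (auto simp: nsq_def mn intro: add_increasing add_increasing2)
      ultimately show ?thesis using nsq_ge_1[OF z] by (simp add: a_def max_def)
    qed
    moreover have "a k > 0" for k by (simp add: a_def)
    ultimately have "nsq z powr (-s) \<le> (a m * a n) powr (-s)"
      using assms by (intro powr_mono2') auto
    then show "nsq z powr (-s) \<le> b z"
      by (simp add: b_def mn powr_mult a_def)
  qed simp
qed

text \<open>The angular sums below are of this shape, with \<open>f\<close> a bounded function of
  the angle and possibly a sign. The second part later turns a uniform pointwise remainder into a
  remainder of the lattice sum.\<close>

lemma summable_nsq_powr_mult: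
  assumes "s > 1" "\<And>z. z \<in> punctured_lattice \<Longrightarrow> \<bar>f z\<bar> \<le> C"
  shows "(\<lambda>z. nsq z powr (-s) * f z) summable_on punctured_lattice"
    and "\<bar>\<Sum>\<^sub>\<infinity>z\<in>punctured_lattice. nsq z powr (-s) * f z\<bar>
           \<le> C * (\<Sum>\<^sub>\<infinity>z\<in>punctured_lattice. nsq z powr (-s))"
proof -
  have s: "(\<lambda>z. C * nsq z powr (-s)) summable_on punctured_lattice"
    by (intro summable_on_cmult_right summable_nsq_powr assms)
  have le: "norm (nsq z powr (-s) * f z) \<le> C * nsq z powr (-s)" if "z \<in> punctured_lattice" for z
    using assms(2)[OF that] by (simp add: abs_mult mult.commute mult_right_mono)
  have as: "(\<lambda>z. norm (nsq z powr (-s) * f z)) summable_on punctured_lattice"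
    by (rule summable_on_comparison_test[OF s]) (use le in auto)
  then show "(\<lambda>z. nsq z powr (-s) * f z) summable_on punctured_lattice"
    by (rule abs_summable_summable)
  have "norm (\<Sum>\<^sub>\<infinity>z\<in>punctured_lattice. nsq z powr (-s) * f z)
        \<le> (\<Sum>\<^sub>\<infinity>z\<in>punctured_lattice. norm (nsq z powr (-s) * f z))"
    by (rule norm_infsum_bound[OF as])
  also have "\<dots> \<le> (\<Sum>\<^sub>\<infinity>z\<in>punctured_lattice. C * nsq z powr (-s))"
    using as s le by (intro infsum_mono)
  also have "\<dots> = C * (\<Sum>\<^sub>\<infinity>z\<in>punctured_lattice. nsq z powr (-s))"
    by (rule infsum_cmult_right')
  finally show "\<bar>\<Sum>\<^sub>\<infinity>z\<in>punctured_lattice. nsq z powr (-s) * f z\<bar>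
           \<le> C * (\<Sum>\<^sub>\<infinity>z\<in>punctured_lattice. nsq z powr (-s))" by simp
qed

text \<open>Four times the Hecke L-function at s of the character (z/|z|)^4 on the Gaussian
  integers, the factor counting units. Only the real part cos (4 theta) is summed.\<close>

definition hecke_sum :: "real \<Rightarrow> real" where
  "hecke_sum s = (\<Sum>\<^sub>\<infinity>z\<in>punctured_lattice. nsq z powr (-s) * (2 * (cos2 z)\<^sup>2 - 1))"

lemma abs_cos4_le_1: "\<bar>2 * (cos2 z)\<^sup>2 - 1\<bar> \<le> 1"
  using cos2_square_le_1[of z] zero_le_power2[of "cos2 z"] unfolding abs_le_iff by linarith

lemma hecke_sum_nonzero:
  assumes "s > 1" shows "hecke_sum s \<noteq> 0"
proof -
  define g :: "complex \<Rightarrow> complex" where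
    "g z = (z\<^sup>2 / of_real ((cmod z)\<^sup>2))\<^sup>2 * of_real (((cmod z)\<^sup>2) powr (-s))" for z
  define h where "h z = Complex (of_int (fst z)) (of_int (snd z))" for z
  have bij: "bij_betw h punctured_lattice (gauss_ints - {0})"
  proof (rule bij_betwI[where g = "\<lambda>z. (\<lfloor>Re z\<rfloor>, \<lfloor>Im z\<rfloor>)"])
    show "h \<in> punctured_lattice \<rightarrow> gauss_ints - {0}"
      by (auto simp: h_def punctured_lattice_def gauss_ints_def complex_eq_iff)
    show "(\<lambda>z. (\<lfloor>Re z\<rfloor>, \<lfloor>Im z\<rfloor>)) \<in> gauss_ints - {0} \<rightarrow> punctured_lattice"
      by (auto simp: punctured_lattice_def gauss_ints_def complex_eq_iff elim!: Ints_cases)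
  qed (auto simp: h_def gauss_ints_def complex_eq_iff elim!: Ints_cases)
  have hn: "(cmod (h z))\<^sup>2 = nsq z" for z by (simp add: h_def nsq_def cmod_power2)
  have normg: "norm (g z) = ((cmod z)\<^sup>2) powr (-s)" if "z \<noteq> 0" for z
    using that by (simp add: g_def norm_mult norm_divide norm_power)
  have hnz: "h z \<noteq> 0" if "z \<in> punctured_lattice" for z
    using bij that by (auto simp: bij_betw_def)
  have Reg: "Re (g (h z)) = nsq z powr (-s) * (2 * (cos2 z)\<^sup>2 - 1)" if "z \<in> punctured_lattice" for z
  proof -
    \<comment> \<open>\<open>w\<close> is exp (2 i theta), so the double-angle formula gives the
      real part of its square.\<close>
    define w where "w = (h z)\<^sup>2 / of_real ((cmod (h z))\<^sup>2)"
    have "Re w = cos2 z" unfolding w_def hn Re_divide_of_real by (simp add: cos2_def h_def power2_eq_square)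
    moreover have "cmod w = 1" using hnz[OF that] by (simp add: w_def norm_divide norm_power)
    then have "(Re w)\<^sup>2 + (Im w)\<^sup>2 = 1" by (metis cmod_power2 one_power2)
    ultimately have "Re (w\<^sup>2) = 2 * (cos2 z)\<^sup>2 - 1" by (simp add: power2_eq_square)
    then show ?thesis by (simp add: g_def hn w_def)
  qed
  have "(\<lambda>z. norm (g (h z))) summable_on punctured_lattice \<longleftrightarrow>
      (\<lambda>z. nsq z powr (-s)) summable_on punctured_lattice"
    by (intro summable_on_cong) (simp add: normg hnz hn)
  then have sum: "(\<lambda>z. norm (g z)) summable_on (gauss_ints - {0})"
    using summable_nsq_powr[OF assms] summable_on_reindex_bij_betw[OF bij, of "\<lambda>z. norm (g z)"] by blast
  have nz: "infsum g (gauss_ints - {0}) \<noteq> 0"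
  proof (rule multiplicative_gauss_sum_nonzero[OF _ sum])
    show "g (a * b) = g a * g b" for a b
      by (simp add: g_def norm_mult power_mult_distrib powr_mult power_divide)
    fix z :: complex assume z: "z \<in> gauss_ints" "cmod z = 1"
    then have "(Re z)\<^sup>2 + (Im z)\<^sup>2 = 1" by (metis cmod_power2 one_power2)
    moreover obtain m n where mn: "Re z = of_int m" "Im z = of_int n"
      using z(1) by (auto simp: gauss_ints_def elim!: Ints_cases)
    ultimately have "real_of_int (m\<^sup>2 + n\<^sup>2) = 1" by simp
    then have "m\<^sup>2 + n\<^sup>2 = 1" by linarith
    \<comment> \<open>A unit has a vanishing coordinate, which forces its fourth power to be
      1.\<close>
    have "m = 0 \<or> n = 0"
    proof (rule ccontr)
      assume "\<not> ?thesis"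
      then have "m\<^sup>2 > 0" "n\<^sup>2 > 0" by simp_all
      then show False using \<open>m\<^sup>2 + n\<^sup>2 = 1\<close> by linarith
    qed
    then have "m\<^sup>2 * n\<^sup>2 = 0" by auto
    then have "(Re z)\<^sup>2 * (Im z)\<^sup>2 = 0" using mn by auto
    then have "z\<^sup>2 * z\<^sup>2 = 1"
      using \<open>(Re z)\<^sup>2 + (Im z)\<^sup>2 = 1\<close> by (auto simp: complex_eq_iff power2_eq_square)
    then show "g z = 1" using z(2) by (simp add: g_def power2_eq_square)
  qed
  have gs: "g summable_on (gauss_ints - {0})" using sum by (rule abs_summable_summable)
  \<comment> \<open>Conjugation permutes the Gaussian integers, so the complex sum is real and
    nonvanishing passes to its real part.\<close>
  have "infsum g (gauss_ints - {0}) = infsum (\<lambda>z. g (cnj z)) (gauss_ints - {0})"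
    by (rule sym, rule infsum_reindex_bij_betw, rule bij_betwI[where g = cnj]) (auto simp: gauss_ints_def)
  also have "\<dots> = cnj (infsum g (gauss_ints - {0}))"
    unfolding infsum_cnj[symmetric] by (rule infsum_cong) (simp add: g_def)
  finally have "Im (infsum g (gauss_ints - {0})) = 0"
    by (simp add: complex_eq_iff)
  moreover have "Re (infsum g (gauss_ints - {0})) = hecke_sum s"
  proof -
    have "Re (infsum g (gauss_ints - {0})) = infsum (\<lambda>z. Re (g z)) (gauss_ints - {0})"
      by (rule infsum_Re[OF gs, symmetric])
    also have "\<dots> = infsum (\<lambda>z. Re (g (h z))) punctured_lattice"
      by (rule infsum_reindex_bij_betw[OF bij, symmetric])
    also have "\<dots> = hecke_sum s" unfolding hecke_sum_def by (intro infsum_cong Reg)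
    finally show ?thesis .
  qed
  ultimately show ?thesis using nz by (auto simp: complex_eq_iff)
qed

text \<open>Weierstrass M-test: as \<open>nsq z\<close> is at least 1, the terms at the left
  endpoint \<open>a\<close> dominate on the whole interval.\<close>

lemma continuous_on_hecke_sum:
  assumes "1 < a" shows "continuous_on {a..b} hecke_sum"
proof -
  have "uniform_limit {a..b} (\<lambda>X s. \<Sum>z\<in>X. nsq z powr (-s) * (2 * (cos2 z)\<^sup>2 - 1))
      (\<lambda>s. \<Sum>\<^sub>\<infinity>z\<in>punctured_lattice. nsq z powr (-s) * (2 * (cos2 z)\<^sup>2 - 1))
      (finite_subsets_at_top punctured_lattice)"
  proof (rule Weierstrass_m_test_general[OF _ summable_nsq_powr[OF assms]])
    fix z s assume "z \<in> punctured_lattice" "s \<in> {a..b}"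
    then have "nsq z powr (-s) \<le> nsq z powr (-a)" using nsq_ge_1[of z] by (intro powr_mono) auto
    moreover have "nsq z powr (-s) * \<bar>2 * (cos2 z)\<^sup>2 - 1\<bar> \<le> nsq z powr (-s) * 1"
      using abs_cos4_le_1 by (intro mult_left_mono) auto
    ultimately show "norm (nsq z powr (-s) * (2 * (cos2 z)\<^sup>2 - 1)) \<le> nsq z powr (-a)"
      by (simp add: abs_mult)
  qed
  then have "continuous_on {a..b} (\<lambda>s. \<Sum>\<^sub>\<infinity>z\<in>punctured_lattice. nsq z powr (-s) * (2 * (cos2 z)\<^sup>2 - 1))"
  proof (rule uniform_limit_theorem[rotated])
    show "\<forall>\<^sub>F X in finite_subsets_at_top punctured_lattice.
        continuous_on {a..b} (\<lambda>s. \<Sum>z\<in>X. nsq z powr (-s) * (2 * (cos2 z)\<^sup>2 - 1))"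
      unfolding eventually_finite_subsets_at_top
      using nsq_pos by (intro exI[of _ "{}"]) (force intro!: continuous_intros)
  qed simp
  then show ?thesis unfolding hecke_sum_def[abs_def] .
qed

text \<open>The four shortest vectors contribute 4. All others have \<open>nsq\<close> at least 2,
  so for a large exponent they contribute at most 1 in absolute value.\<close>

lemma hecke_sum_pos_large: "\<exists>t\<ge>s. hecke_sum t > 0"
proof -
  define M where "M = (\<Sum>\<^sub>\<infinity>z\<in>punctured_lattice. nsq z powr (-2))"
  have M: "M \<ge> 0" unfolding M_def by (intro infsum_nonneg) simp
  \<comment> \<open>The logarithm makes \<open>2 powr (2 - t)\<close> at most
    \<open>1 / (M + 1)\<close>, which beats the total mass \<open>M\<close> at exponent 2.\<close>
  define t where "t = max s 2 + log 2 (M + 1)"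
  have t: "t \<ge> s" "t \<ge> 2" and t2: "t - 2 \<ge> log 2 (M + 1)"
    using zero_le_log_cancel_iff[of 2 "M + 1"] M unfolding t_def by linarith+
  define U where "U = {(1, 0), (-1, 0), (0, 1), (0, -1 :: int) :: int \<times> int}"
  define f where "f z = nsq z powr (-t) * (2 * (cos2 z)\<^sup>2 - 1)" for z
  have UZ: "U \<subseteq> punctured_lattice" "finite U" by (auto simp: U_def punctured_lattice_def)
  have fs: "f summable_on punctured_lattice"
    unfolding f_def[abs_def] by (rule summable_nsq_powr_mult(1)) (use t abs_cos4_le_1 in auto)
  have "infsum f (punctured_lattice - U) = hecke_sum t - sum f U"
    using infsum_Diff[OF fs _ UZ(1)] UZ(2) by (simp add: hecke_sum_def f_def[abs_def])
  moreover have "sum f U = 4"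
    by (simp add: U_def f_def nsq_def cos2_def)
  moreover have "\<bar>infsum f (punctured_lattice - U)\<bar> \<le> 1"
  proof -
    have s2: "(\<lambda>z. 2 powr (2 - t) * nsq z powr (-2)) summable_on punctured_lattice"
      by (intro summable_on_cmult_right summable_nsq_powr) simp
    then have s2': "(\<lambda>z. 2 powr (2 - t) * nsq z powr (-2)) summable_on (punctured_lattice - U)"
      by (rule summable_on_subset_banach) auto
    have le: "norm (f z) \<le> 2 powr (2 - t) * nsq z powr (-2)" if z: "z \<in> punctured_lattice - U" for z
    proof -
      obtain m n where mn: "z = (m, n)" by fastforce
      have "m\<^sup>2 + n\<^sup>2 \<noteq> 1"
      proof
        assume 1: "m\<^sup>2 + n\<^sup>2 = 1"
        then have "m\<^sup>2 \<le> 1" "n\<^sup>2 \<le> 1" by (smt (verit) zero_le_power2)+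
        then have "m \<in> {-1, 0, 1}" "n \<in> {-1, 0, 1}"
          by (auto simp: abs_square_le_1)
        with 1 z show False by (auto simp: U_def mn)
      qed
      moreover have "real_of_int (m\<^sup>2 + n\<^sup>2) \<ge> 1" using nsq_ge_1[of z] z by (simp add: mn nsq_def)
      then have "m\<^sup>2 + n\<^sup>2 \<ge> 1" by linarith
      ultimately have "m\<^sup>2 + n\<^sup>2 \<ge> 2" by linarith
      then have "real_of_int (m\<^sup>2 + n\<^sup>2) \<ge> 2" by linarith
      then have "nsq z \<ge> 2" by (simp add: mn nsq_def)
      then have "nsq z powr (2 - t) \<le> 2 powr (2 - t)" using t by (intro powr_mono2') auto
      then have "nsq z powr (2 - t) * nsq z powr (-2) \<le> 2 powr (2 - t) * nsq z powr (-2)"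
        by (intro mult_right_mono) auto
      also have "nsq z powr (2 - t) * nsq z powr (-2) = nsq z powr (-t)"
        by (simp add: powr_add[symmetric])
      finally have "nsq z powr (-t) \<le> 2 powr (2 - t) * nsq z powr (-2)" .
      moreover have "nsq z powr (-t) * \<bar>2 * (cos2 z)\<^sup>2 - 1\<bar> \<le> nsq z powr (-t) * 1"
        using abs_cos4_le_1 by (intro mult_left_mono) auto
      ultimately show ?thesis by (simp add: f_def abs_mult)
    qed
    have as: "(\<lambda>z. norm (f z)) summable_on (punctured_lattice - U)"
      by (rule summable_on_comparison_test[OF s2']) (use le in auto)
    have "norm (infsum f (punctured_lattice - U)) \<le> infsum (\<lambda>z. norm (f z)) (punctured_lattice - U)"
      by (rule norm_infsum_bound[OF as])
    also have "\<dots> \<le> infsum (\<lambda>z. 2 powr (2 - t) * nsq z powr (-2)) (punctured_lattice - U)"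
      by (rule infsum_mono[OF as s2' le])
    also have "\<dots> \<le> infsum (\<lambda>z. 2 powr (2 - t) * nsq z powr (-2)) punctured_lattice"
      by (rule infsum_mono2[OF s2' s2]) auto
    also have "\<dots> = 2 powr (2 - t) * M" unfolding M_def by (rule infsum_cmult_right')
    also have "\<dots> \<le> 1"
    proof -
      have "2 powr (2 - t) \<le> 2 powr (- log 2 (M + 1))" using t2 by (intro powr_mono) auto
      also have "\<dots> = 1 / (M + 1)" using M by (simp add: powr_minus divide_inverse)
      finally have "2 powr (2 - t) * M \<le> 1 / (M + 1) * M" using M by (intro mult_right_mono)
      also have "\<dots> \<le> 1" using M by simp
      finally show ?thesis .
    qed
    finally show ?thesis by simp
  qed
  ultimately have "hecke_sum t > 0" by linarith
  then show ?thesis using t by blast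
qed

lemma hecke_sum_pos:
  assumes "s > 1" shows "hecke_sum s > 0"
proof (rule ccontr)
  assume "\<not> hecke_sum s > 0"
  then have le: "hecke_sum s \<le> 0" by simp
  obtain t where t: "t \<ge> s" "hecke_sum t > 0" using hecke_sum_pos_large by blast
  have "\<exists>x\<ge>s. x \<le> t \<and> hecke_sum x = 0"
    using le t continuous_on_hecke_sum[OF assms] by (intro IVT') auto
  then show False using hecke_sum_nonzero assms by fastforce
qed


subsection \<open>Second-order expansion over rectangular lattices\<close>

text \<open>
  For \<open>y = exp x\<close>, a lattice vector with \<open>cos2\<close> equal to \<open>u\<close> has its squared length multiplied by \<open>D\<close>, so the
  expansion of \<open>D powr (-s)\<close> has to be uniform in \<open>u\<close>. The logarithmic derivative \<open>R\<close> of \<open>D\<close>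
  satisfies \<open>R' = 4 - R\<^sup>2\<close>, which keeps all derivatives explicit and bounded.
\<close>

lemma rect_powr_expansion:
  fixes s :: real
  assumes "s > 0"
  obtains K where "\<And>u x :: real. \<bar>u\<bar> \<le> 1 \<Longrightarrow> \<bar>x\<bar> \<le> 1 \<Longrightarrow>
    \<bar>((1 + u) / 2 * exp (2 * x) + (1 - u) / 2 * exp (- 2 * x)) powr (-s)
      - (1 - 2 * s * u * x + s * ((s - 1) + (s + 1) * (2 * u\<^sup>2 - 1)) * x\<^sup>2)\<bar> \<le> K * \<bar>x\<bar> ^ 3"
proof
  \<comment> \<open>This bounds the third derivative divided by 3!: \<open>exp (2 * s)\<close>
    bounds \<open>k\<close>, and the other factor uses |R| <= 2.\<close>
  define K where "K = exp (2 * s) * (s * 2 * ((s\<^sup>2 + s) * 4 + 4 * s) + 2 * (s\<^sup>2 + s) * 2 * 4) / 6"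
  fix u x :: real
  assume u: "\<bar>u\<bar> \<le> 1" and x: "\<bar>x\<bar> \<le> 1"
  define D where "D t = (1 + u) / 2 * exp (2 * t) + (1 - u) / 2 * exp (- 2 * t)" for t :: real
  define D' where "D' t = (1 + u) * exp (2 * t) - (1 - u) * exp (- 2 * t)" for t :: real
  define R where "R t = D' t / D t" for t
  define k where "k t = D t powr (-s)" for t
  have u01: "1 + u \<ge> 0" "1 - u \<ge> 0" using u by auto
  have Dpos: "D t > 0" for t
  proof (cases "u = -1")
    case False
    then have "1 + u > 0" using u by auto
    then show ?thesis using u01 unfolding D_def by (intro add_pos_nonneg) auto
  qed (simp add: D_def)
  have dD: "(D has_real_derivative D' t) (at t)" for t
    unfolding D_def[abs_def] D'_def by (auto intro!: derivative_eq_intros simp: field_simps)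
  have dD': "(D' has_real_derivative 4 * D t) (at t)" for t
    unfolding D'_def[abs_def] D_def by (auto intro!: derivative_eq_intros simp: field_simps)
  have dR: "(R has_real_derivative 4 - (R t)\<^sup>2) (at t)" for t
    unfolding R_def[abs_def] using Dpos[of t]
    by (auto intro!: derivative_eq_intros dD dD' simp: field_simps power2_eq_square)
  have dk: "(k has_real_derivative - s * k t * R t) (at t)" for t
  proof -
    have "D t powr (-s - 1) = D t powr (-s) / D t"
      using Dpos[of t] by (simp add: powr_diff)
    then show ?thesis unfolding k_def[abs_def] R_def using Dpos[of t]
      by (auto intro!: derivative_eq_intros dD simp: field_simps)
  qed
  have R2: "\<bar>R t\<bar> \<le> 2" for t
  proof -
    \<comment> \<open>Both exponentials have non-negative coefficients, so \<open>D'\<close> is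
      dominated by \<open>2 * D\<close>.\<close>
    have "0 \<le> (1 + u) * exp (2 * t)" "0 \<le> (1 - u) * exp (- 2 * t)" using u01 by auto
    then have "\<bar>D' t\<bar> \<le> (1 + u) * exp (2 * t) + (1 - u) * exp (- 2 * t)"
      unfolding D'_def by linarith
    also have "\<dots> = 2 * D t" by (simp add: D_def)
    finally have "\<bar>D' t\<bar> \<le> 2 * D t" .
    then show ?thesis using Dpos[of t] by (simp add: R_def divide_le_eq)
  qed
  \<comment> \<open>\<open>k\<close> and its first three derivatives, computed from k' = -s k R and
    R' = 4 - R^2.\<close>
  define d where "d m = [k, \<lambda>t. - s * k t * R t, \<lambda>t. k t * ((s\<^sup>2 + s) * (R t)\<^sup>2 - 4 * s),
      \<lambda>t. k t * (- s * R t * ((s\<^sup>2 + s) * (R t)\<^sup>2 - 4 * s) + 2 * (s\<^sup>2 + s) * R t * (4 - (R t)\<^sup>2))] ! m" for m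
  have "\<exists>t. \<bar>t\<bar> \<le> \<bar>x\<bar> \<and> k x = (\<Sum>m<3. d m 0 / fact m * x ^ m) + d 3 t / fact 3 * x ^ 3"
  proof (rule Maclaurin_bi_le; (intro allI impI)?)
    fix m :: nat and t :: real assume "m < 3 \<and> \<bar>t\<bar> \<le> \<bar>x\<bar>"
    then consider "m = 0" | "m = 1" | "m = 2" by linarith
    then show "(d m has_real_derivative d (Suc m) t) (at t)"
      by cases (use dk[of t] in \<open>auto simp: d_def nth_Cons' power2_eq_square algebra_simps
          intro!: derivative_eq_intros dk dR\<close>)
  qed (simp add: d_def)
  then obtain t where t: "\<bar>t\<bar> \<le> \<bar>x\<bar>"
    and kx: "k x = (\<Sum>m<3. d m 0 / fact m * x ^ m) + d 3 t / fact 3 * x ^ 3" by blast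
  have D0: "D 0 = 1" "R 0 = 2 * u" "k 0 = 1" by (simp_all add: D_def R_def k_def D'_def field_simps)
  have "(\<Sum>m<3. d m 0 / fact m * x ^ m)
      = 1 - 2 * s * u * x + s * ((s - 1) + (s + 1) * (2 * u\<^sup>2 - 1)) * x\<^sup>2"
    by (simp add: d_def D0 eval_nat_numeral field_simps)
  then have eq: "k x - (1 - 2 * s * u * x + s * ((s - 1) + (s + 1) * (2 * u\<^sup>2 - 1)) * x\<^sup>2)
      = d 3 t / 6 * x ^ 3"
    using kx by (simp add: fact_numeral)
  have kt: "\<bar>k t\<bar> \<le> exp (2 * s)"
  proof -
    \<comment> \<open>For |t| <= 1 both exponentials are at least \<open>exp (-2)\<close>, and their
      coefficients in \<open>D\<close> add up to 1.\<close>
    have e: "exp (2 * t) \<ge> exp (-2)" "exp (- 2 * t) \<ge> exp (-2)" using t x by auto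
    have "(1 + u) / 2 * exp (-2) + (1 - u) / 2 * exp (-2) \<le> D t"
      unfolding D_def using e u01 by (intro add_mono mult_left_mono) auto
    then have "exp (-2) \<le> D t" by (simp add: field_simps)
    then have "k t \<le> exp (-2) powr (-s)" unfolding k_def using assms by (intro powr_mono2') auto
    also have "exp (-2) powr (-s) = exp (2 * s)" by (simp add: powr_def mult.commute)
    finally show ?thesis by (simp add: k_def)
  qed
  have Rsq: "(R t)\<^sup>2 \<le> 4" using power_mono[OF R2[of t], of 2] by simp
  have "\<bar>- s * R t * ((s\<^sup>2 + s) * (R t)\<^sup>2 - 4 * s) + 2 * (s\<^sup>2 + s) * R t * (4 - (R t)\<^sup>2)\<bar>
      \<le> s * 2 * ((s\<^sup>2 + s) * 4 + 4 * s) + 2 * (s\<^sup>2 + s) * 2 * 4"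
  proof (rule order_trans[OF abs_triangle_ineq add_mono])
    have "0 \<le> (s\<^sup>2 + s) * (R t)\<^sup>2" "(s\<^sup>2 + s) * (R t)\<^sup>2 \<le> (s\<^sup>2 + s) * 4"
      using assms Rsq by (simp, intro mult_left_mono) auto
    then have "\<bar>(s\<^sup>2 + s) * (R t)\<^sup>2 - 4 * s\<bar> \<le> (s\<^sup>2 + s) * 4 + 4 * s"
      using assms by linarith
    then show "\<bar>- s * R t * ((s\<^sup>2 + s) * (R t)\<^sup>2 - 4 * s)\<bar> \<le> s * 2 * ((s\<^sup>2 + s) * 4 + 4 * s)"
      using assms R2[of t] unfolding abs_mult by (intro mult_mono) auto
    have "\<bar>4 - (R t)\<^sup>2\<bar> \<le> 4" using Rsq by auto
    then show "\<bar>2 * (s\<^sup>2 + s) * R t * (4 - (R t)\<^sup>2)\<bar> \<le> 2 * (s\<^sup>2 + s) * 2 * 4"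
      using assms R2[of t] unfolding abs_mult by (intro mult_mono) auto
  qed
  moreover have "d 3 t = k t * (- s * R t * ((s\<^sup>2 + s) * (R t)\<^sup>2 - 4 * s)
      + 2 * (s\<^sup>2 + s) * R t * (4 - (R t)\<^sup>2))"
    by (simp add: d_def eval_nat_numeral)
  ultimately have "\<bar>d 3 t\<bar> \<le> exp (2 * s) * (s * 2 * ((s\<^sup>2 + s) * 4 + 4 * s) + 2 * (s\<^sup>2 + s) * 2 * 4)"
    using kt by (simp only: abs_mult[of "k t"]) (rule mult_mono, auto)
  then have "\<bar>d 3 t / 6\<bar> \<le> K" by (simp add: K_def)
  then have "\<bar>d 3 t / 6\<bar> * \<bar>x\<bar> ^ 3 \<le> K * \<bar>x\<bar> ^ 3" by (intro mult_right_mono) auto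
  then show "\<bar>((1 + u) / 2 * exp (2 * x) + (1 - u) / 2 * exp (- 2 * x)) powr (-s)
      - (1 - 2 * s * u * x + s * ((s - 1) + (s + 1) * (2 * u\<^sup>2 - 1)) * x\<^sup>2)\<bar> \<le> K * \<bar>x\<bar> ^ 3"
    using eq unfolding k_def D_def by (simp only: abs_mult power_abs)
qed

lemma abs_weight_le:
  fixes s u :: real
  assumes "s > 1" "\<bar>u\<bar> \<le> 1" shows "\<bar>(s - 1) + (s + 1) * u\<bar> \<le> 2 * s"
proof -
  have "\<bar>(s + 1) * u\<bar> \<le> (s + 1) * 1"
    unfolding abs_mult using assms by (intro mult_mono) auto
  then show ?thesis using assms abs_triangle_ineq[of "s - 1" "(s + 1) * u"] by simp
qed

text \<open>Swapping the coordinates preserves \<open>nsq\<close> and \<open>c\<close> but negates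
  \<open>cos2\<close>, so the sum is its own negative. This makes the square lattice a critical
  point.\<close>

lemma infsum_cos2_eq_0:
  assumes "\<And>z. c (prod.swap z) = c z"
  shows "(\<Sum>\<^sub>\<infinity>z\<in>punctured_lattice. nsq z powr (-s) * (c z * cos2 z)) = 0"
proof -
  have "bij_betw prod.swap punctured_lattice punctured_lattice"
    by (rule bij_betwI[where g = prod.swap]) (auto simp: punctured_lattice_def)
  then have "(\<Sum>\<^sub>\<infinity>z\<in>punctured_lattice. nsq z powr (-s) * (c z * cos2 z))
      = (\<Sum>\<^sub>\<infinity>z\<in>punctured_lattice. nsq (prod.swap z) powr (-s) * (c (prod.swap z) * cos2 (prod.swap z)))"
    by (rule infsum_reindex_bij_betw[symmetric])
  also have "\<dots> = (\<Sum>\<^sub>\<infinity>z\<in>punctured_lattice. - (nsq z powr (-s) * (c z * cos2 z)))"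
  proof (rule infsum_cong)
    fix z
    have "nsq (prod.swap z) = nsq z" by (simp add: nsq_def add.commute)
    moreover from this have "cos2 (prod.swap z) = - cos2 z"
      by (simp add: cos2_def minus_divide_left)
    ultimately show "nsq (prod.swap z) powr (-s) * (c (prod.swap z) * cos2 (prod.swap z))
        = - (nsq z powr (-s) * (c z * cos2 z))" by (simp add: assms)
  qed
  also have "\<dots> = - (\<Sum>\<^sub>\<infinity>z\<in>punctured_lattice. nsq z powr (-s) * (c z * cos2 z))"
    by (rule infsum_uminus)
  finally show ?thesis by simp
qed

definition rect_sum :: "(int \<times> int \<Rightarrow> real) \<Rightarrow> real \<Rightarrow> real \<Rightarrow> real" where
  "rect_sum c s y = (\<Sum>\<^sub>\<infinity>z\<in>punctured_lattice.
     c z * (of_int (fst z) ^ 2 * y\<^sup>2 + of_int (snd z) ^ 2 / y\<^sup>2) powr (-s))"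

text \<open>Twice the coefficient of x^2 in \<open>rect_sum c s (exp x)\<close>, as
  \<open>rect_sum_expansion\<close> shows for bounded symmetric charges.\<close>

definition rect_curvature :: "(int \<times> int \<Rightarrow> real) \<Rightarrow> real \<Rightarrow> real" where
  "rect_curvature c s = 2 * s * (\<Sum>\<^sub>\<infinity>z\<in>punctured_lattice.
     nsq z powr (-s) * (c z * ((s - 1) + (s + 1) * (2 * (cos2 z)\<^sup>2 - 1))))"

text \<open>By the half-angle formulas, the squares of the coordinates are \<open>nsq z\<close>
  times (1 + cos2)/2 and (1 - cos2)/2.\<close>

lemma rect_form_eq:
  assumes "z \<in> punctured_lattice"
  shows "of_int (fst z) ^ 2 * (exp x)\<^sup>2 + of_int (snd z) ^ 2 / (exp x)\<^sup>2
    = nsq z * ((1 + cos2 z) / 2 * exp (2 * x) + (1 - cos2 z) / 2 * exp (- 2 * x))"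
proof -
  have e: "(exp x)\<^sup>2 = exp (2 * x)" by (simp add: exp_double)
  have "nsq z * ((1 + cos2 z) / 2) = of_int (fst z) ^ 2" "nsq z * ((1 - cos2 z) / 2) = of_int (snd z) ^ 2"
    using nsq_pos[OF assms] by (simp_all add: cos2_def field_simps) (simp_all add: nsq_def algebra_simps)
  moreover have "exp (- 2 * x) = inverse (exp (2 * x))" by (simp add: exp_minus[symmetric])
  moreover have "nsq z * ((1 + cos2 z) / 2 * exp (2 * x) + (1 - cos2 z) / 2 * exp (- 2 * x))
      = (nsq z * ((1 + cos2 z) / 2)) * exp (2 * x) + (nsq z * ((1 - cos2 z) / 2)) * exp (- 2 * x)"
    by (simp only: distrib_left mult.assoc)
  ultimately show ?thesis unfolding e by (simp only: divide_inverse)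
qed

text \<open>The remainder in \<open>rect_powr_expansion\<close> is uniform in the angle, so the
  expansion may be summed over the lattice. The linear term drops out by the swap symmetry.\<close>

lemma rect_sum_expansion:
  assumes s: "s > 1" and c: "\<And>z. \<bar>c z\<bar> \<le> 1" "\<And>z. c (prod.swap z) = c z"
  obtains K where "\<And>x. \<bar>x\<bar> \<le> 1 \<Longrightarrow>
    \<bar>rect_sum c s (exp x) - (rect_sum c s 1 + rect_curvature c s / 2 * x\<^sup>2)\<bar> \<le> K * \<bar>x\<bar> ^ 3"
proof -
  obtain K where K: "\<And>u x :: real. \<bar>u\<bar> \<le> 1 \<Longrightarrow> \<bar>x\<bar> \<le> 1 \<Longrightarrow>
    \<bar>((1 + u) / 2 * exp (2 * x) + (1 - u) / 2 * exp (- 2 * x)) powr (-s)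
      - (1 - 2 * s * u * x + s * ((s - 1) + (s + 1) * (2 * u\<^sup>2 - 1)) * x\<^sup>2)\<bar> \<le> K * \<bar>x\<bar> ^ 3"
    using rect_powr_expansion[of s] s by auto
  define Z where "Z = (\<Sum>\<^sub>\<infinity>z\<in>punctured_lattice. nsq z powr (-s))"
  define v where "v z = (s - 1) + (s + 1) * (2 * (cos2 z)\<^sup>2 - 1)" for z
  define W where "W f = (\<Sum>\<^sub>\<infinity>z\<in>punctured_lattice. nsq z powr (-s) * f z)" for f
  have W: "((\<lambda>z. nsq z powr (-s) * f z) has_sum W f) punctured_lattice"
    if "\<And>z. z \<in> punctured_lattice \<Longrightarrow> \<bar>f z\<bar> \<le> C" for f C
    unfolding W_def by (intro has_sum_infsum summable_nsq_powr_mult(1)[OF s that])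
  have Wu: "W (\<lambda>z. c z * cos2 z) = 0" unfolding W_def by (rule infsum_cos2_eq_0[of c, OF c(2)])
  have Wv: "rect_curvature c s = 2 * s * W (\<lambda>z. c z * v z)" unfolding W_def v_def rect_curvature_def ..
  have F1: "rect_sum c s 1 = W c"
    unfolding W_def rect_sum_def by (intro infsum_cong) (simp add: nsq_def)
  have vb: "\<bar>v z\<bar> \<le> 2 * s" for z
    unfolding v_def by (rule abs_weight_le[OF s abs_cos4_le_1])
  show ?thesis
  proof
    fix x :: real assume x: "\<bar>x\<bar> \<le> 1"
    define D where "D z = (1 + cos2 z) / 2 * exp (2 * x) + (1 - cos2 z) / 2 * exp (- 2 * x)" for z
    define r where "r z = D z powr (-s) - (1 - 2 * s * cos2 z * x + s * v z * x\<^sup>2)" for z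
    have rb: "\<bar>c z * r z\<bar> \<le> K * \<bar>x\<bar> ^ 3" for z
    proof -
      have r: "\<bar>r z\<bar> \<le> K * \<bar>x\<bar> ^ 3" unfolding r_def D_def v_def by (rule K[OF abs_cos2_le_1 x])
      have "\<bar>c z\<bar> * \<bar>r z\<bar> \<le> 1 * \<bar>r z\<bar>" using c(1) by (intro mult_right_mono) auto
      then show ?thesis using r by (simp add: abs_mult)
    qed
    \<comment> \<open>Each term is split into remainder, constant, linear and quadratic parts, all
      separately summable.\<close>
    have "((\<lambda>z. nsq z powr (-s) * (c z * r z) + (nsq z powr (-s) * c z
            + (- 2 * s * x) * (nsq z powr (-s) * (c z * cos2 z))
            + (s * x\<^sup>2) * (nsq z powr (-s) * (c z * v z))))
        has_sum W (\<lambda>z. c z * r z) + (W c + (- 2 * s * x) * W (\<lambda>z. c z * cos2 z)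
            + (s * x\<^sup>2) * W (\<lambda>z. c z * v z))) punctured_lattice"
    proof (intro has_sum_add has_sum_cmult_right)
      show "((\<lambda>z. nsq z powr (-s) * (c z * cos2 z)) has_sum W (\<lambda>z. c z * cos2 z)) punctured_lattice"
        using mult_mono[OF c(1) abs_cos2_le_1] by (intro W[of _ "1 * 1"]) (simp add: abs_mult)
      show "((\<lambda>z. nsq z powr (-s) * (c z * v z)) has_sum W (\<lambda>z. c z * v z)) punctured_lattice"
        using mult_mono[OF c(1) vb] by (intro W[of _ "1 * (2 * s)"]) (simp add: abs_mult)
      show "((\<lambda>z. nsq z powr (-s) * (c z * r z)) has_sum W (\<lambda>z. c z * r z)) punctured_lattice"
        by (rule W[OF rb])
      show "((\<lambda>z. nsq z powr (-s) * c z) has_sum W c) punctured_lattice"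
        by (rule W[OF c(1)])
    qed
    moreover have "rect_sum c s (exp x) = (\<Sum>\<^sub>\<infinity>z\<in>punctured_lattice.
        nsq z powr (-s) * (c z * r z) + (nsq z powr (-s) * c z
            + (- 2 * s * x) * (nsq z powr (-s) * (c z * cos2 z))
            + (s * x\<^sup>2) * (nsq z powr (-s) * (c z * v z))))"
      unfolding rect_sum_def
    proof (rule infsum_cong)
      fix z assume z: "z \<in> punctured_lattice"
      have Dr: "D z powr (-s) = r z + 1 - 2 * s * cos2 z * x + s * v z * x\<^sup>2" by (simp add: r_def)
      show "c z * (of_int (fst z) ^ 2 * (exp x)\<^sup>2 + of_int (snd z) ^ 2 / (exp x)\<^sup>2) powr (-s)
        = nsq z powr (-s) * (c z * r z) + (nsq z powr (-s) * c z
            + (- 2 * s * x) * (nsq z powr (-s) * (c z * cos2 z))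
            + (s * x\<^sup>2) * (nsq z powr (-s) * (c z * v z)))"
        unfolding rect_form_eq[OF z] powr_mult D_def[symmetric] Dr by (simp add: algebra_simps)
    qed
    ultimately have "rect_sum c s (exp x) = W (\<lambda>z. c z * r z) + (W c + s * x\<^sup>2 * W (\<lambda>z. c z * v z))"
      by (simp add: infsumI Wu)
    then have "rect_sum c s (exp x) - (rect_sum c s 1 + rect_curvature c s / 2 * x\<^sup>2) = W (\<lambda>z. c z * r z)"
      by (simp add: F1 Wv)
    moreover have "\<bar>W (\<lambda>z. c z * r z)\<bar> \<le> K * \<bar>x\<bar> ^ 3 * Z"
      unfolding W_def Z_def by (rule summable_nsq_powr_mult(2)[OF s]) (rule rb)
    ultimately show "\<bar>rect_sum c s (exp x) - (rect_sum c s 1 + rect_curvature c s / 2 * x\<^sup>2)\<bar>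
        \<le> K * Z * \<bar>x\<bar> ^ 3" by (simp add: ac_simps)
  qed
qed

text \<open>The link to \<open>S1\<close> and \<open>S2\<close>. With u = cos2, the numerator
  divided by nsq^2 is (s + 1) u^2 - 1 - u, whereas half the curvature weight is (s + 1) u^2 - 1; the
  extra -u sums to zero by symmetry.\<close>

lemma rect_curvature_eq:
  assumes s: "s > 1" and c: "\<And>z. \<bar>c z\<bar> \<le> 1" "\<And>z. c (prod.swap z) = c z"
  shows "rect_curvature c s = 4 * s * (\<Sum>\<^sub>\<infinity>(m, n)\<in>UNIV - {(0, 0)}.
     c (m, n) * ((s + 1) * (of_int n ^ 2 - of_int m ^ 2) ^ 2 - 2 * of_int m ^ 4
        - 2 * of_int m ^ 2 * of_int n ^ 2) / (of_int m ^ 2 + of_int n ^ 2) powr (s + 2))"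
proof -
  define f where "f z = nsq z powr (-s) * (c z * ((s - 1) + (s + 1) * (2 * (cos2 z)\<^sup>2 - 1)))" for z
  define g where "g z = nsq z powr (-s) * (c z * cos2 z)" for z
  note vb = abs_weight_le[OF s abs_cos4_le_1]
  have f: "f summable_on punctured_lattice"
    unfolding f_def[abs_def] using mult_mono[OF c(1) vb]
    by (intro summable_nsq_powr_mult(1)[OF s, of _ "1 * (2 * s)"]) (simp add: abs_mult)
  have g: "g summable_on punctured_lattice"
    unfolding g_def[abs_def] using mult_mono[OF c(1) abs_cos2_le_1]
    by (intro summable_nsq_powr_mult(1)[OF s, of _ "1 * 1"]) (simp add: abs_mult)
  have "(\<Sum>\<^sub>\<infinity>(m, n)\<in>UNIV - {(0, 0)}.
     c (m, n) * ((s + 1) * (of_int n ^ 2 - of_int m ^ 2) ^ 2 - 2 * of_int m ^ 4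
        - 2 * of_int m ^ 2 * of_int n ^ 2) / (of_int m ^ 2 + of_int n ^ 2) powr (s + 2))
      = (\<Sum>\<^sub>\<infinity>z\<in>punctured_lattice. 1 / 2 * f z + - 1 * g z)"
    unfolding punctured_lattice_def
  proof (rule infsum_cong, unfold split_paired_all prod.case)
    fix m n :: int assume "(m, n) \<in> UNIV - {(0, 0)}"
    then have N: "nsq (m, n) > 0" by (intro nsq_pos) (simp add: punctured_lattice_def)
    define a b where "a = real_of_int m" and "b = real_of_int n"
    have Nab: "nsq (m, n) = a\<^sup>2 + b\<^sup>2" by (simp add: nsq_def a_def b_def)
    have u: "cos2 (m, n) * nsq (m, n) = a\<^sup>2 - b\<^sup>2" using N by (simp add: cos2_def a_def b_def)
    have p: "nsq (m, n) powr (s + 2) = (nsq (m, n))\<^sup>2 / nsq (m, n) powr (-s)"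
      using N by (simp add: powr_add powr_minus field_simps)
    \<comment> \<open>The last two terms combine to -2 a^2 (a^2 + b^2), where 2 a^2 = (1 + u) (a^2 +
      b^2).\<close>
    have "(s + 1) * (b\<^sup>2 - a\<^sup>2)\<^sup>2 - 2 * a ^ 4 - 2 * a\<^sup>2 * b\<^sup>2
        = ((s + 1) * (cos2 (m, n))\<^sup>2 - 1 - cos2 (m, n)) * (nsq (m, n))\<^sup>2"
    proof -
      have "((s + 1) * (cos2 (m, n))\<^sup>2 - 1 - cos2 (m, n)) * (nsq (m, n))\<^sup>2
          = (s + 1) * (cos2 (m, n) * nsq (m, n))\<^sup>2 - (nsq (m, n))\<^sup>2 - cos2 (m, n) * nsq (m, n) * nsq (m, n)"
        by (simp add: algebra_simps power2_eq_square)
      also have "\<dots> = (s + 1) * (a\<^sup>2 - b\<^sup>2)\<^sup>2 - (a\<^sup>2 + b\<^sup>2)\<^sup>2 - (a\<^sup>2 - b\<^sup>2) * (a\<^sup>2 + b\<^sup>2)"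
        by (simp only: u) (simp only: Nab)
      also have "\<dots> = (s + 1) * (b\<^sup>2 - a\<^sup>2)\<^sup>2 - 2 * a ^ 4 - 2 * a\<^sup>2 * b\<^sup>2"
        by (simp add: algebra_simps power2_eq_square power4_eq_xxxx)
      finally show ?thesis ..
    qed
    then have "c (m, n) * ((s + 1) * (b\<^sup>2 - a\<^sup>2)\<^sup>2 - 2 * a ^ 4 - 2 * a\<^sup>2 * b\<^sup>2) / nsq (m, n) powr (s + 2)
        = c (m, n) * ((s + 1) * (cos2 (m, n))\<^sup>2 - 1 - cos2 (m, n)) * nsq (m, n) powr (-s)"
      unfolding p using N by simp
    also have "\<dots> = 1 / 2 * f (m, n) + - 1 * g (m, n)"
      by (simp add: f_def g_def field_simps)
    finally show "c (m, n) * ((s + 1) * (of_int n ^ 2 - of_int m ^ 2) ^ 2 - 2 * of_int m ^ 4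
        - 2 * of_int m ^ 2 * of_int n ^ 2) / (of_int m ^ 2 + of_int n ^ 2) powr (s + 2)
        = 1 / 2 * f (m, n) + - 1 * g (m, n)" unfolding Nab a_def b_def .
  qed
  also have "\<dots> = 1 / 2 * infsum f punctured_lattice + - 1 * infsum g punctured_lattice"
    by (subst infsum_add) (use f g in \<open>auto intro: summable_on_cmult_right simp only: infsum_cmult_right'\<close>)
  also have "infsum g punctured_lattice = 0"
    unfolding g_def by (rule infsum_cos2_eq_0[of c, OF c(2)])
  finally show ?thesis unfolding rect_curvature_def f_def by simp
qed


subsection \<open>Signs of the second derivatives\<close>

definition alt_sign :: "int \<times> int \<Rightarrow> real" where
  "alt_sign z = (-1) powi (fst z + snd z)"

lemma alt_sign_eq: "alt_sign z = (if even (fst z + snd z) then 1 else -1)"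
  by (simp add: alt_sign_def power_int_minus_left)

lemma abs_alt_sign_le: "\<bar>alt_sign z\<bar> \<le> 1"
  by (simp add: alt_sign_eq)

lemma alt_sign_swap: "alt_sign (prod.swap z) = alt_sign z"
  by (simp add: alt_sign_eq add.commute)

text \<open>\<open>(m - n, m + n)\<close> is the product of \<open>m + i n\<close> and \<open>1 + i\<close>.\<close>

lemma infsum_alt_sign:
  assumes s: "s > 1" and f: "\<And>z. \<bar>f z\<bar> \<le> C"
  shows "(\<Sum>\<^sub>\<infinity>z\<in>punctured_lattice. nsq z powr (-s) * (alt_sign z * f z))
    = 2 powr (1 - s) * (\<Sum>\<^sub>\<infinity>z\<in>punctured_lattice. nsq z powr (-s) * f (fst z - snd z, fst z + snd z))
      - (\<Sum>\<^sub>\<infinity>z\<in>punctured_lattice. nsq z powr (-s) * f z)"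
proof -
  define E where "E = {z \<in> punctured_lattice. even (fst z + snd z)}"
  define h where "h z = (fst z - snd z, fst z + snd z)" for z :: "int \<times> int"
  define g where "g z = nsq z powr (-s) * f z" for z
  have bij: "bij_betw h punctured_lattice E"
  \<comment> \<open>The inverse is division by 1 + i; both halves are exact when the coordinate sum
    is even.\<close>
  proof (rule bij_betwI[where g = "\<lambda>z. ((fst z + snd z) div 2, (snd z - fst z) div 2)"])
    show "(\<lambda>z. ((fst z + snd z) div 2, (snd z - fst z) div 2)) \<in> E \<rightarrow> punctured_lattice"
    proof
      fix z assume z: "z \<in> E"
      then obtain k where "fst z + snd z = 2 * k" unfolding E_def by (blast elim: evenE)
      moreover from this have "snd z - fst z = 2 * (snd z - k)" by simp
      ultimately show "((fst z + snd z) div 2, (snd z - fst z) div 2) \<in> punctured_lattice"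
        using z by (cases z) (auto simp: E_def punctured_lattice_def)
    qed
    show "h ((fst z + snd z) div 2, (snd z - fst z) div 2) = z" if z: "z \<in> E" for z
    proof -
      obtain k where k: "fst z + snd z = 2 * k" using z unfolding E_def by (blast elim: evenE)
      then have "(fst z + snd z) div 2 = k" "snd z - fst z = 2 * (snd z - k)" by simp_all
      then have "(snd z - fst z) div 2 = snd z - k" by simp
      then show ?thesis using k by (simp add: h_def prod_eq_iff)
    qed
  qed (auto simp: h_def E_def punctured_lattice_def)
  have gs: "g summable_on punctured_lattice"
    unfolding g_def[abs_def] by (rule summable_nsq_powr_mult(1)[OF s f])
  have gE: "g summable_on E" by (rule summable_on_subset_banach[OF gs]) (auto simp: E_def)
  have EP: "E \<subseteq> punctured_lattice" by (auto simp: E_def)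
  \<comment> \<open>The alternating sign is twice the indicator of \<open>E\<close> minus 1.\<close>
  have "(\<Sum>\<^sub>\<infinity>z\<in>punctured_lattice. nsq z powr (-s) * (alt_sign z * f z))
      = (\<Sum>\<^sub>\<infinity>z\<in>punctured_lattice. 2 * (if z \<in> E then g z else 0) + - g z)"
    by (intro infsum_cong) (simp add: E_def alt_sign_eq g_def)
  also have "\<dots> = (\<Sum>\<^sub>\<infinity>z\<in>punctured_lattice. 2 * (if z \<in> E then g z else 0))
      + (\<Sum>\<^sub>\<infinity>z\<in>punctured_lattice. - g z)"
  proof (rule infsum_add)
    have "(\<lambda>z. if z \<in> E then g z else 0) summable_on punctured_lattice \<longleftrightarrow> g summable_on E"
      by (intro summable_on_cong_neutral) (use EP in auto)
    then show "(\<lambda>z. 2 * (if z \<in> E then g z else 0)) summable_on punctured_lattice"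
      using gE by (intro summable_on_cmult_right) simp
    show "(\<lambda>z. - g z) summable_on punctured_lattice"
      using gs by (simp add: summable_on_uminus)
  qed
  also have "(\<Sum>\<^sub>\<infinity>z\<in>punctured_lattice. 2 * (if z \<in> E then g z else 0))
      = 2 * (\<Sum>\<^sub>\<infinity>z\<in>punctured_lattice. if z \<in> E then g z else 0)"
    by (rule infsum_cmult_right')
  also have "(\<Sum>\<^sub>\<infinity>z\<in>punctured_lattice. if z \<in> E then g z else 0) = infsum g E"
    by (intro infsum_cong_neutral) (use EP in auto)
  also have "infsum g E = (\<Sum>\<^sub>\<infinity>z\<in>punctured_lattice. g (h z))"
    by (rule infsum_reindex_bij_betw[OF bij, symmetric])
  also have "\<dots> = (\<Sum>\<^sub>\<infinity>z\<in>punctured_lattice. 2 powr (-s) * (nsq z powr (-s) * f (h z)))"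
  proof (rule infsum_cong)
    fix z
    have "nsq (h z) = 2 * nsq z" by (simp add: nsq_def h_def power2_eq_square algebra_simps)
    then show "g (h z) = 2 powr (-s) * (nsq z powr (-s) * f (h z))" by (simp add: g_def powr_mult)
  qed
  also have "\<dots> = 2 powr (-s) * (\<Sum>\<^sub>\<infinity>z\<in>punctured_lattice. nsq z powr (-s) * f (h z))"
    by (rule infsum_cmult_right')
  also have "2 * (2 powr (-s) * (\<Sum>\<^sub>\<infinity>z\<in>punctured_lattice. nsq z powr (-s) * f (h z)))
      = 2 powr (1 - s) * (\<Sum>\<^sub>\<infinity>z\<in>punctured_lattice. nsq z powr (-s) * f (h z))"
    by (simp add: powr_diff powr_minus divide_inverse)
  finally show ?thesis by (simp add: g_def h_def infsum_uminus)
qed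

text \<open>The map is a rotation by an eighth of a turn, up to scale, and replaces cos (2 theta) by
  -sin (2 theta).\<close>

lemma cos2_rotate:
  assumes "z \<in> punctured_lattice"
  shows "(cos2 (fst z - snd z, fst z + snd z))\<^sup>2 = 1 - (cos2 z)\<^sup>2"
proof -
  define a b where "a = real_of_int (fst z)" and "b = real_of_int (snd z)"
  have N: "a\<^sup>2 + b\<^sup>2 > 0" using nsq_pos[OF assms] by (simp add: nsq_def a_def b_def)
  have "cos2 (fst z - snd z, fst z + snd z) = - (2 * a * b) / (a\<^sup>2 + b\<^sup>2)"
  proof -
    have "(a - b)\<^sup>2 - (a + b)\<^sup>2 = 2 * - (2 * a * b)" "(a - b)\<^sup>2 + (a + b)\<^sup>2 = 2 * (a\<^sup>2 + b\<^sup>2)"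
      by (simp_all add: power2_eq_square algebra_simps)
    then show ?thesis
      unfolding cos2_def nsq_def fst_conv snd_conv of_int_add of_int_diff a_def[symmetric] b_def[symmetric]
      by (simp only: mult_divide_mult_cancel_left_if) simp
  qed
  moreover have "cos2 z = (a\<^sup>2 - b\<^sup>2) / (a\<^sup>2 + b\<^sup>2)" by (simp add: cos2_def nsq_def a_def b_def)
  moreover have "(2 * a * b)\<^sup>2 = (a\<^sup>2 + b\<^sup>2)\<^sup>2 - (a\<^sup>2 - b\<^sup>2)\<^sup>2"
    by (simp add: power2_eq_square algebra_simps)
  ultimately have "(cos2 (fst z - snd z, fst z + snd z))\<^sup>2 = ((a\<^sup>2 + b\<^sup>2)\<^sup>2 - (a\<^sup>2 - b\<^sup>2)\<^sup>2) / (a\<^sup>2 + b\<^sup>2)\<^sup>2"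
    and "(cos2 z)\<^sup>2 = (a\<^sup>2 - b\<^sup>2)\<^sup>2 / (a\<^sup>2 + b\<^sup>2)\<^sup>2"
    by (simp_all only: power_divide power2_minus)
  then show ?thesis using N by (auto simp: diff_divide_distrib)
qed

lemma infsum_weight:
  assumes s: "s > 1"
  shows "(\<Sum>\<^sub>\<infinity>z\<in>punctured_lattice. nsq z powr (-s) * (a + b * (2 * (cos2 z)\<^sup>2 - 1)))
    = a * (\<Sum>\<^sub>\<infinity>z\<in>punctured_lattice. nsq z powr (-s)) + b * hecke_sum s"
proof -
  have "((\<lambda>z. a * nsq z powr (-s) + b * (nsq z powr (-s) * (2 * (cos2 z)\<^sup>2 - 1)))
      has_sum a * (\<Sum>\<^sub>\<infinity>z\<in>punctured_lattice. nsq z powr (-s)) + b * hecke_sum s) punctured_lattice"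
    unfolding hecke_sum_def
    by (intro has_sum_add has_sum_cmult_right has_sum_infsum summable_nsq_powr[OF s]
        summable_nsq_powr_mult(1)[OF s abs_cos4_le_1])
  then show ?thesis by (intro infsumI) (simp add: algebra_simps)
qed

text \<open>As |cos (4 theta)| <= 1, this sum is at least \<open>hecke_sum s\<close>, which is
  positive.\<close>

lemma nsq_sum_pos:
  assumes s: "s > 1" shows "(\<Sum>\<^sub>\<infinity>z\<in>punctured_lattice. nsq z powr (-s)) > 0"
proof -
  have "hecke_sum s \<le> 1 * (\<Sum>\<^sub>\<infinity>z\<in>punctured_lattice. nsq z powr (-s))"
    unfolding hecke_sum_def
    using summable_nsq_powr_mult(2)[OF s abs_cos4_le_1] by (rule order_trans[OF abs_ge_self])
  then show ?thesis using hecke_sum_pos[OF s] by simp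
qed

lemma rect_curvature_pos:
  assumes s: "s > 1" shows "rect_curvature (\<lambda>_. 1) s > 0"
  unfolding rect_curvature_def mult_1 infsum_weight[OF s]
  using s nsq_sum_pos[OF s] hecke_sum_pos[OF s] by (simp add: add_pos_pos)

lemma rect_curvature_alt_neg:
  assumes s: "s > 1" shows "rect_curvature alt_sign s < 0"
proof -
  define Z where "Z = (\<Sum>\<^sub>\<infinity>z\<in>punctured_lattice. nsq z powr (-s))"
  have pos: "Z > 0" "hecke_sum s > 0" unfolding Z_def using nsq_sum_pos[OF s] hecke_sum_pos[OF s] .
  have "(\<Sum>\<^sub>\<infinity>z\<in>punctured_lattice. nsq z powr (-s) * (alt_sign z * ((s - 1) + (s + 1) * (2 * (cos2 z)\<^sup>2 - 1))))
     = 2 powr (1 - s) * (\<Sum>\<^sub>\<infinity>z\<in>punctured_lattice. nsq z powr (-s) *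
          ((s - 1) + (s + 1) * (2 * (cos2 (fst z - snd z, fst z + snd z))\<^sup>2 - 1)))
       - (\<Sum>\<^sub>\<infinity>z\<in>punctured_lattice. nsq z powr (-s) * ((s - 1) + (s + 1) * (2 * (cos2 z)\<^sup>2 - 1)))"
    by (rule infsum_alt_sign[OF s abs_weight_le[OF s abs_cos4_le_1]])
  \<comment> \<open>The rotation negates cos (4 theta), so the coefficient \<open>s + 1\<close>
    changes sign while \<open>s - 1\<close> stays.\<close>
  also have "(\<Sum>\<^sub>\<infinity>z\<in>punctured_lattice. nsq z powr (-s) *
          ((s - 1) + (s + 1) * (2 * (cos2 (fst z - snd z, fst z + snd z))\<^sup>2 - 1)))
      = (\<Sum>\<^sub>\<infinity>z\<in>punctured_lattice. nsq z powr (-s) * ((s - 1) + - (s + 1) * (2 * (cos2 z)\<^sup>2 - 1)))"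
    by (intro infsum_cong) (simp add: cos2_rotate algebra_simps)
  finally have "(\<Sum>\<^sub>\<infinity>z\<in>punctured_lattice. nsq z powr (-s) *
        (alt_sign z * ((s - 1) + (s + 1) * (2 * (cos2 z)\<^sup>2 - 1))))
     = - ((s - 1) * (1 - 2 powr (1 - s)) * Z + (s + 1) * (1 + 2 powr (1 - s)) * hecke_sum s)"
    unfolding infsum_weight[OF s] Z_def[symmetric] by (simp add: algebra_simps)
  \<comment> \<open>This makes the coefficient of \<open>Z\<close> positive, so both summands inside
    the negation are positive.\<close>
  moreover have "2 powr (1 - s) < 1" using s powr_less_mono[of "1 - s" 0 2] by simp
  then have "(s - 1) * (1 - 2 powr (1 - s)) * Z + (s + 1) * (1 + 2 powr (1 - s)) * hecke_sum s > 0"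
    using s pos by (intro add_pos_pos mult_pos_pos) (auto simp: add_pos_pos)
  ultimately show ?thesis unfolding rect_curvature_def using s by (simp add: mult_pos_neg)
qed

lemma S1_eq: "p > 1 \<Longrightarrow> S1 p = rect_curvature (\<lambda>_. 1) p"
  by (subst rect_curvature_eq) (simp_all add: S1_def)

lemma S2_eq: "q > 1 \<Longrightarrow> S2 q = rect_curvature alt_sign q"
  by (subst rect_curvature_eq) (simp_all add: S2_def abs_alt_sign_le alt_sign_swap, simp add: alt_sign_def)

section \<open>Energies of rectangular lattices and the critical volume\<close>

lemma energy_rect_lattice:
  assumes "V > 0" "y > 0"
  shows "energy (\<lambda>r. r powr (-p)) (\<lambda>r. r powr (-q)) (scaled_rect_lattice V y)
    = V powr (-p) * rect_sum (\<lambda>_. 1) p y + V powr (-q) * rect_sum alt_sign q y"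
proof -
  define L where "L = scaled_rect_lattice V y"
  define u v :: "real^2" where "u = vector [sqrt V * y, 0]" and "v = vector [0, sqrt V * inverse y]"
  define h where "h z = of_int (fst z) *\<^sub>R u + of_int (snd z) *\<^sub>R v" for z :: "int \<times> int"
  have B: "orthogonal_basis L u v"
    using assms by (auto simp: L_def u_def v_def orthogonal_basis_def scaled_rect_lattice_eq orthogonal_def
        inner_vec_def sum_2 vec_eq_iff forall_2)
  have inj: "inj h"
  proof (rule injI)
    fix z w assume "h z = h w"
    then show "z = w" using orth_coeffs[of u v] B unfolding h_def orthogonal_basis_def
      by (metis of_int_eq_iff prod_eq_iff)
  qed
  have "L = lattice_of u v" using B by (simp add: orthogonal_basis_def)
  moreover have "range h = lattice_of u v"
  proof (intro equalityI subsetI)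
    fix x assume "x \<in> lattice_of u v"
    then obtain m n where "x = h (m, n)" unfolding lattice_of_def h_def by auto
    then show "x \<in> range h" by blast
  qed (auto simp: lattice_of_def h_def)
  moreover have "h (0, 0) = 0" by (simp add: h_def)
  ultimately have "h ` punctured_lattice = L - {0}"
    unfolding punctured_lattice_def image_set_diff[OF inj] by simp
  then have bij: "bij_betw h punctured_lattice (L - {0})"
    using inj by (metis bij_betw_def inj_on_subset subset_UNIV)
  have n: "((norm (h z))\<^sup>2) powr a
      = V powr a * (of_int (fst z) ^ 2 * y\<^sup>2 + of_int (snd z) ^ 2 / y\<^sup>2) powr a" for z a
  proof -
    \<comment> \<open>Squared lengths are proportional to the volume, so each power-law sum depends
      on \<open>V\<close> only through the factor \<open>V powr a\<close>.\<close>
    have "(norm (h z))\<^sup>2 = V * (of_int (fst z) ^ 2 * y\<^sup>2 + of_int (snd z) ^ 2 / y\<^sup>2)"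
      unfolding power2_norm_eq_inner using assms
      by (simp add: h_def u_def v_def inner_vec_def sum_2 power2_eq_square field_simps)
    then show ?thesis by (simp add: powr_mult)
  qed
  have c: "charge L (h z) = alt_sign z" for z
    unfolding h_def alt_sign_def by (rule charge_eq[OF B])
  have sum: "(\<Sum>\<^sub>\<infinity>x\<in>L - {0}. w x * ((norm x)\<^sup>2) powr (-s)) = V powr (-s) * rect_sum c s y"
    if "\<And>z. w (h z) = c z" for w c s
  proof -
    have "(\<Sum>\<^sub>\<infinity>x\<in>L - {0}. w x * ((norm x)\<^sup>2) powr (-s))
        = (\<Sum>\<^sub>\<infinity>z\<in>punctured_lattice. w (h z) * ((norm (h z))\<^sup>2) powr (-s))"
      by (rule infsum_reindex_bij_betw[OF bij, symmetric])
    also have "\<dots> = (\<Sum>\<^sub>\<infinity>z\<in>punctured_lattice. V powr (-s) *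
        (c z * (of_int (fst z) ^ 2 * y\<^sup>2 + of_int (snd z) ^ 2 / y\<^sup>2) powr (-s)))"
      unfolding n that by (simp add: ac_simps)
    also have "\<dots> = V powr (-s) * rect_sum c s y"
      unfolding rect_sum_def by (rule infsum_cmult_right')
    finally show ?thesis .
  qed
  show ?thesis unfolding energy_def L_def[symmetric]
    using sum[of "\<lambda>_. 1" "\<lambda>_. 1" p] sum[of "charge L" alt_sign q] c by simp
qed

text \<open>In the variable x = ln y the positive quadratic term dominates the cubic error near
  0.\<close>

lemma strict_local_min_on_of_expansion:
  fixes f :: "real \<Rightarrow> real"
  assumes "T > 0" and exp: "\<And>x. \<bar>x\<bar> \<le> 1 \<Longrightarrow> \<bar>f (exp x) - (f 1 + T * x\<^sup>2)\<bar> \<le> K * \<bar>x\<bar> ^ 3"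
  shows "strict_local_min_on f {0<..} 1"
  unfolding strict_local_min_on_def
proof
  have "((\<lambda>y. \<bar>ln y\<bar>) \<longlongrightarrow> \<bar>ln 1\<bar>) (at (1 :: real) within {0<..})"
    by (intro tendsto_rabs tendsto_ln tendsto_ident_at) auto
  then have *: "((\<lambda>y. \<bar>ln y\<bar>) \<longlongrightarrow> 0) (at (1 :: real) within {0<..})" by simp
  \<comment> \<open>The first bound puts \<open>ln y\<close> in the range of the expansion; the
    second gives K |x| < T. The denominator is positive whatever the sign of
    \<open>K\<close>.\<close>
  have "\<forall>\<^sub>F y in at (1 :: real) within {0<..}. \<bar>ln y\<bar> < min 1 (T / (\<bar>K\<bar> + 1))"
    by (rule order_tendstoD(2)[OF *]) (use assms(1) in auto)
  moreover have "\<forall>\<^sub>F y in at (1 :: real) within {0<..}. y \<in> {0<..} \<and> y \<noteq> 1"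
    by (simp add: eventually_at_filter)
  ultimately show "\<forall>\<^sub>F y in at 1 within {0<..}. f 1 < f y"
  proof eventually_elim
    case (elim y)
    define x where "x = ln y"
    have y: "y = exp x" and x0: "x \<noteq> 0" using elim(2) by (auto simp: x_def)
    have x: "\<bar>x\<bar> \<le> 1" "\<bar>x\<bar> < T / (\<bar>K\<bar> + 1)" using elim(1) by (auto simp: x_def)
    have "\<bar>x\<bar> * (\<bar>K\<bar> + 1) < T" using x(2) by (simp add: pos_less_divide_eq)
    moreover have "K * \<bar>x\<bar> \<le> \<bar>x\<bar> * (\<bar>K\<bar> + 1)" 
      using mult_right_mono[of K "\<bar>K\<bar> + 1" "\<bar>x\<bar>"] by (simp add: mult.commute)
    ultimately have "K * \<bar>x\<bar> < T" by linarith
    then have "K * \<bar>x\<bar> * x\<^sup>2 < T * x\<^sup>2" using x0 by (intro mult_strict_right_mono) auto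
    moreover have "K * \<bar>x\<bar> ^ 3 = K * \<bar>x\<bar> * x\<^sup>2" by (simp add: power3_eq_cube power2_eq_square)
    ultimately show "f 1 < f y" using exp[OF x(1)] unfolding y by linarith
  qed
qed simp

text \<open>\<open>\<sigma> = -1\<close> turns maxima into minima.\<close>

lemma scaled_energy_strict_local_min:
  fixes \<sigma> :: real
  assumes "p > 1" "q > 1" "V > 0" and T: "\<sigma> * (V powr (-p) * S1 p + V powr (-q) * S2 q) > 0"
  shows "strict_local_min_on
    (\<lambda>y. \<sigma> * energy (\<lambda>r. r powr (-p)) (\<lambda>r. r powr (-q)) (scaled_rect_lattice V y)) {0<..} 1"
proof -
  define f where "f = (\<lambda>y. \<sigma> * energy (\<lambda>r. r powr (-p)) (\<lambda>r. r powr (-q)) (scaled_rect_lattice V y))"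
  obtain K1 where K1: "\<And>x. \<bar>x\<bar> \<le> 1 \<Longrightarrow> \<bar>rect_sum (\<lambda>_. 1) p (exp x)
      - (rect_sum (\<lambda>_. 1) p 1 + S1 p / 2 * x\<^sup>2)\<bar> \<le> K1 * \<bar>x\<bar> ^ 3"
    using rect_sum_expansion[OF assms(1), of "\<lambda>_. 1"] unfolding S1_eq[OF assms(1)] by auto
  obtain K2 where K2: "\<And>x. \<bar>x\<bar> \<le> 1 \<Longrightarrow> \<bar>rect_sum alt_sign q (exp x)
      - (rect_sum alt_sign q 1 + S2 q / 2 * x\<^sup>2)\<bar> \<le> K2 * \<bar>x\<bar> ^ 3"
    using rect_sum_expansion[OF assms(2), of alt_sign] abs_alt_sign_le alt_sign_swap
    unfolding S2_eq[OF assms(2)] by auto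
  have "strict_local_min_on f {0<..} 1"
  proof (rule strict_local_min_on_of_expansion)
    show "\<sigma> * (V powr (-p) * S1 p + V powr (-q) * S2 q) / 2 > 0" using T by simp
    fix x :: real assume x: "\<bar>x\<bar> \<le> 1"
    define r1 where "r1 = rect_sum (\<lambda>_. 1) p (exp x) - (rect_sum (\<lambda>_. 1) p 1 + S1 p / 2 * x\<^sup>2)"
    define r2 where "r2 = rect_sum alt_sign q (exp x) - (rect_sum alt_sign q 1 + S2 q / 2 * x\<^sup>2)"
    have "f (exp x) - (f 1 + \<sigma> * (V powr (-p) * S1 p + V powr (-q) * S2 q) / 2 * x\<^sup>2)
        = \<sigma> * (V powr (-p) * r1 + V powr (-q) * r2)"
      using assms(3) by (simp add: f_def energy_rect_lattice r1_def r2_def field_simps)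
    moreover have "\<bar>V powr (-p) * r1 + V powr (-q) * r2\<bar>
        \<le> V powr (-p) * (K1 * \<bar>x\<bar> ^ 3) + V powr (-q) * (K2 * \<bar>x\<bar> ^ 3)"
      using K1[OF x] K2[OF x] unfolding r1_def[symmetric] r2_def[symmetric]
      by (intro order_trans[OF abs_triangle_ineq] add_mono) (auto simp: abs_mult intro: mult_left_mono)
    then have "\<bar>\<sigma> * (V powr (-p) * r1 + V powr (-q) * r2)\<bar>
        \<le> \<bar>\<sigma>\<bar> * (V powr (-p) * (K1 * \<bar>x\<bar> ^ 3) + V powr (-q) * (K2 * \<bar>x\<bar> ^ 3))"
      unfolding abs_mult by (intro mult_left_mono) auto
    ultimately show "\<bar>f (exp x) - (f 1 + \<sigma> * (V powr (-p) * S1 p + V powr (-q) * S2 q) / 2 * x\<^sup>2)\<bar>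
        \<le> (\<bar>\<sigma>\<bar> * (V powr (-p) * K1 + V powr (-q) * K2)) * \<bar>x\<bar> ^ 3"
      by (simp add: algebra_simps)
  qed
  then show ?thesis unfolding f_def .
qed

theorem theorem2p3:
  fixes p q :: real
  assumes "1 < q" and "q < p"
  shows "0 < S1 p / - S2 q \<and> 0 < V_crit p q \<and>
    (\<forall>V. 0 < V \<and> V < V_crit p q \<longrightarrow>
       square_strict_local_min (energy (\<lambda>r. r powr (- p)) (\<lambda>r. r powr (- q))) V) \<and>
    (\<forall>V. V_crit p q < V \<longrightarrow>
       square_strict_local_max (energy (\<lambda>r. r powr (- p)) (\<lambda>r. r powr (- q))) V)"
proof -
  define T where "T V = V powr (-p) * S1 p + V powr (-q) * S2 q" for V
  have p: "p > 1" using assms by simp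
  have S: "S1 p > 0" "S2 q < 0"
    using rect_curvature_pos[OF p] rect_curvature_alt_neg[OF assms(1)]
    by (simp_all add: S1_eq[OF p] S2_eq[OF assms(1)])
  then have quot: "S1 p / - S2 q > 0" by (intro divide_pos_pos) auto
  have crit: "V_crit p q > 0" "V_crit p q powr (p - q) = S1 p / - S2 q"
  proof -
    show "V_crit p q > 0" unfolding V_crit_def using quot by (simp only: powr_gt_zero)
    show "V_crit p q powr (p - q) = S1 p / - S2 q"
      unfolding V_crit_def powr_powr using assms(2) powr_one[OF less_imp_le[OF quot]] by simp
  qed
  \<comment> \<open>Factoring out a positive quantity shows that \<open>T\<close> has the sign of
    \<open>V_crit p q powr (p - q) - V powr (p - q)\<close>, hence changes sign exactly at the
    critical volume.\<close>
  have T: "T V = V powr (-p) * - S2 q * (V_crit p q powr (p - q) - V powr (p - q))" if "V > 0" for V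
  proof -
    have "V powr (-p) * V powr (p - q) = V powr (-q)" by (simp add: powr_add[symmetric])
    then show ?thesis unfolding crit(2) T_def using S(2) by (simp add: algebra_simps)
  qed
  have "square_strict_local_min (energy (\<lambda>r. r powr (- p)) (\<lambda>r. r powr (- q))) V"
    if V: "0 < V" "V < V_crit p q" for V
  proof -
    have "V powr (p - q) < V_crit p q powr (p - q)" using V assms(2) by (intro powr_less_mono2) auto
    then have "1 * T V > 0" unfolding T[OF V(1)] using V(1) S(2) by (simp add: zero_less_mult_iff mult_less_0_iff)
    then show ?thesis
      using scaled_energy_strict_local_min[OF p assms(1) V(1), of 1]
      unfolding square_strict_local_min_def T_def by simp
  qed
  moreover have "square_strict_local_max (energy (\<lambda>r. r powr (- p)) (\<lambda>r. r powr (- q))) V"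
    if V: "V_crit p q < V" for V
  proof -
    have V0: "V > 0" using V crit(1) by simp
    have "V_crit p q powr (p - q) < V powr (p - q)" using V crit(1) assms(2) by (intro powr_less_mono2) auto
    then have "-1 * T V > 0" unfolding T[OF V0] using V0 S(2) by (simp add: zero_less_mult_iff mult_less_0_iff)
    then show ?thesis
      using scaled_energy_strict_local_min[OF p assms(1) V0, of "-1"]
      unfolding square_strict_local_max_def T_def strict_local_max_on_def strict_local_min_on_def by simp
  qed
  ultimately show ?thesis using quot crit(1) by blast
qed

end
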